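(* If $\Gamma \vdash V = W : A$ is derivable in $\lambda_{\mathrm{eff}}$, then $[\![V]\!] = [\![W]\!]$ in every $\lambda_{\mathrm{eff}}$-model. Similarly, if $\Gamma \vdash M = N : C$ or $\Gamma \vdash H = H' : \Sigma \Rightarrow C$ is derivable, then $[\![M]\!] = [\![N]\!]$ or $[\![H]\!] = [\![H']\!]$, respectively, in every $\lambda_{\mathrm{eff}}$-model.
   Context: The calculus $\lambda_{\mathrm{eff}}$ (fine-grain call-by-value with deep effect handlers). Value types $A ::= A \to C \mid \prod_{i=1}^n A_i$; computation types $C ::= A\,!\,\Sigma$; a signature $\Sigma$ is a finite set of entries $\mathtt{op} : A \to B$ (operation symbol $\mathtt{op}$ with argument type $A$ and result type $B$; in a signature entry the arrow denotes an operation signature, not a function type); handler types $\Sigma \Rightarrow C$. Values $V ::= x \mid \lambda x.M \mid \langle V_1,\dots,V_n\rangle \mid \pi_i\,V$; computations $M ::= V\,W \mid \mathtt{return}\ V \mid \mathtt{let}\ x \Leftarrow M\ \mathtt{in}\ N \mid \mathtt{op}(V) \mid \mathtt{handle}\ M\ \mathtt{with}\ H\ \mathtt{to}\ x.\,N$; handlers $H ::= \emptyset \mid \{\mathtt{op}(x,k)\mapsto M\}\cup H$. Typing: $\mathtt{return}\ V : A!\Sigma$ if $V : A$; $\mathtt{let}$ sequences two computations with the same $\Sigma$; $\mathtt{op}(V) : B!\Sigma$ if $(\mathtt{op} : A \to B)\in\Sigma$ and $V:A$; $H : \Sigma \Rightarrow C$ has for each $(\mathtt{op}: A_{\mathtt{op}}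 \to B_{\mathtt{op}})\in\Sigma$ a clause $\mathtt{op}(x,k)\mapsto M_{\mathtt{op}}$ with $\Gamma, x:A_{\mathtt{op}}, k:B_{\mathtt{op}}\to C \vdash M_{\mathtt{op}} : C$; $\mathtt{handle}\ M\ \mathtt{with}\ H\ \mathtt{to}\ x.N : C$ if $M : A!\Sigma$, $H : \Sigma\Rightarrow C$, $\Gamma,x:A\vdash N : C$. The equational judgements form the least congruence containing: $\beta/\eta$ for functions and products; the monad laws for $\mathtt{let}$; and (Handle-Ret) $\mathtt{handle}\ \mathtt{return}\ V\ \mathtt{with}\ H\ \mathtt{to}\ x.M = M[V/x]$; (Handle-Let) $\mathtt{handle}\ (\mathtt{let}\ x\Leftarrow L\ \mathtt{in}\ M)\ \mathtt{with}\ H\ \mathtt{to}\ y.N = \mathtt{handle}\ L\ \mathtt{with}\ H\ \mathtt{to}\ x.(\mathtt{handle}\ M\ \mathtt{with}\ H\ \mathtt{to}\ y.N)$; (Handle-Op) $\mathtt{handle}\ \mathtt{op}(V)\ \mathtt{with}\ H\ \mathtt{to}\ x.M = M_{\mathtt{op}}[V/x, \lambda x.M/k]$. Models: let $\mathcal{C}$ be cartesian; for a strong monad $T$ with Kleisli adjunction $J \dashv K$ ($KX = TX$), a Kleisli exponential $(Y \Rightarrow_T Z)$ satisfies $\mathcal{C}_T(J(X\times Y),Z)\cong \mathcal{C}(X, Y\Rightarrow_T Z)$, with currying $\Lambda$ and evaluation $\mathrm{ev} : (Y\Rightarrow_T Z)\times Y \to TZ$. A semantic signature $S$ is a finite partial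 map from operation symbols to pairs of objects. $\mathcal{H}_S(X) = \prod_{(\mathtt{op}:A_{\mathtt{op}}\to B_{\mathtt{op}})\in S}((A_{\mathtt{op}}\times(B_{\mathtt{op}}\Rightarrow_T X))\Rightarrow_T X)$. A $\lambda_{\mathrm{eff}}$-model consists of a cartesian category $\mathcal{C}$, strong monads $T_S$ for each semantic signature $S$ such that $\mathcal{C}$ has Kleisli exponentials for each $T_S$, morphisms $[\![\mathtt{op}]\!]_S : A_{\mathtt{op}} \to T_S B_{\mathtt{op}}$, and morphisms $\mathrm{handle}_{S,S',X} : \mathcal{H}_S(X)\times T_S T_{S'}X \to T_{S'}X$ (with $\mathcal{H}_S(X)$ built from $T_{S'}$) satisfying: $\mathrm{handle}\circ(\mathrm{id}\times\eta^{T_S})=\pi_2$; $\mathrm{handle}\circ(\mathrm{id}\times\mu^{T_S}) = \mathrm{handle}\circ(\mathrm{id}\times T_S\,\mathrm{handle})\circ\langle\pi_1,\mathrm{st}^{T_S}\rangle$; $\mathrm{handle}\circ(\mathrm{id}\times a_{\mathtt{op}}) = \mathrm{ev}\circ(\pi_{\mathtt{op}}\times\mathrm{id})$, where $a_{\mathtt{op}} = T_S\,\mathrm{ev}\circ\mathrm{st}^{T_S}\circ\mathrm{swap}\circ([\![\mathtt{op}]\!]_S\times\mathrm{id}) : A_{\mathtt{op}}\times(B_{\mathtt{op}}\Rightarrow_{T_{S'}}X)\to T_S T_{S'}X$. Interpretation: $[\![A\to B!\Sigma]\!] = [\![A]\!]\Rightarrow_{T_{[\![\Sigma]\!]}}[\![B]\!]$,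 products to products; $[\![V]\!] : [\![\Gamma]\!]\to[\![A]\!]$, $[\![M]\!] : [\![\Gamma]\!]\to T_{[\![\Sigma]\!]}[\![A]\!]$, $[\![H]\!] : [\![\Gamma]\!]\to\mathcal{H}_{[\![\Sigma]\!]}([\![A]\!])$ for $H:\Sigma\Rightarrow A!\Sigma'$; defined as for fine-grain call-by-value (abstraction by $\Lambda$, application by $\mathrm{ev}$, return by $\eta$, let by strong Kleisli extension), with $[\![\mathtt{op}(V)]\!] = [\![\mathtt{op}]\!]\circ[\![V]\!]$, $[\![H]\!]$ the tuple of the curried clauses $\Lambda[\![M_{\mathtt{op}}]\!]$, and $[\![\mathtt{handle}\ M\ \mathtt{with}\ H\ \mathtt{to}\ x.N]\!] = \mathrm{handle}\circ\langle[\![H]\!], T_{[\![\Sigma]\!]}[\![N]\!]\circ\mathrm{st}\circ\langle\mathrm{id},[\![M]\!]\rangle\rangle$. *)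

theory Defs
  imports "HOL-Library.Finite_Map"
begin

section \<open>Syntax of the calculus\<close>

text \<open>
  Signatures and handlers are finite maps: every operation symbol has at most one entry in a
  signature, and at most one clause in a handler.
\<close>

datatype 'op ty = Fun "'op ty" "'op cty" | Prod "'op ty list"
     and 'op cty = Comp "'op ty" "('op, 'op ty \<times> 'op ty) fmap"

type_synonym 'op sig = "('op, 'op ty \<times> 'op ty) fmap"

text \<open>
  Terms are taken up to renaming of bound variables, by means of de Bruijn indices. In a clause
  \<open>op(x,k) \<mapsto> M\<close> index 0 is \<open>k\<close> and index 1 is \<open>x\<close>. Projections are numbered from 0.

  The denotation of a term is defined by recursion on its typing derivation. So that this
  derivation is unique, terms are read in Church style: an abstraction carries the type of its
  bound variable, \<open>return\<close> and \<open>op\<close> carry their signature. All other types can be recovered from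
  these and from the context (\<open>unique_typing\<close> below).
\<close>

datatype 'op val =
    Var nat
  | Lam "'op ty" "'op comp"
  | Tup "'op val list"
  | Proj nat "'op val"
and 'op comp =
    App "'op val" "'op val"
  | Ret "'op sig" "'op val"
  | LetIn "'op comp" "'op comp"
  | Op "'op sig" 'op "'op val"
  | Handle "'op comp" "('op, 'op comp) fmap" "'op comp"

type_synonym 'op hdl = "('op, 'op comp) fmap"
type_synonym 'op ctx = "'op ty list"

definition up_ren :: "(nat \<Rightarrow> nat) \<Rightarrow> nat \<Rightarrow> nat" where
  "up_ren r = case_nat 0 (\<lambda>i. Suc (r i))"

primrec ren_val :: "(nat \<Rightarrow> nat) \<Rightarrow> 'op val \<Rightarrow> 'op val"
    and ren_comp :: "(nat \<Rightarrow> nat) \<Rightarrow> 'op comp \<Rightarrow> 'op comp" where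
  "ren_val r (Var i) = Var (r i)"
| "ren_val r (Lam A M) = Lam A (ren_comp (up_ren r) M)"
| "ren_val r (Tup Vs) = Tup (map (ren_val r) Vs)"
| "ren_val r (Proj i V) = Proj i (ren_val r V)"
| "ren_comp r (App V W) = App (ren_val r V) (ren_val r W)"
| "ren_comp r (Ret \<Sigma> V) = Ret \<Sigma> (ren_val r V)"
| "ren_comp r (LetIn M N) = LetIn (ren_comp r M) (ren_comp (up_ren r) N)"
| "ren_comp r (Op \<Sigma> op V) = Op \<Sigma> op (ren_val r V)"
| "ren_comp r (Handle M H N) =
     Handle (ren_comp r M) (fmmap (ren_comp (up_ren (up_ren r))) H) (ren_comp (up_ren r) N)"

definition ren_hdl :: "(nat \<Rightarrow> nat) \<Rightarrow> 'op hdl \<Rightarrow> 'op hdl" where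
  "ren_hdl r H = fmmap (ren_comp (up_ren (up_ren r))) H"

definition up_sub :: "(nat \<Rightarrow> 'op val) \<Rightarrow> nat \<Rightarrow> 'op val" where
  "up_sub s = case_nat (Var 0) (\<lambda>i. ren_val Suc (s i))"

primrec sub_val :: "(nat \<Rightarrow> 'op val) \<Rightarrow> 'op val \<Rightarrow> 'op val"
    and sub_comp :: "(nat \<Rightarrow> 'op val) \<Rightarrow> 'op comp \<Rightarrow> 'op comp" where
  "sub_val s (Var i) = s i"
| "sub_val s (Lam A M) = Lam A (sub_comp (up_sub s) M)"
| "sub_val s (Tup Vs) = Tup (map (sub_val s) Vs)"
| "sub_val s (Proj i V) = Proj i (sub_val s V)"
| "sub_comp s (App V W) = App (sub_val s V) (sub_val s W)"
| "sub_comp s (Ret \<Sigma> V) = Ret \<Sigma> (sub_val s V)"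
| "sub_comp s (LetIn M N) = LetIn (sub_comp s M) (sub_comp (up_sub s) N)"
| "sub_comp s (Op \<Sigma> op V) = Op \<Sigma> op (sub_val s V)"
| "sub_comp s (Handle M H N) =
     Handle (sub_comp s M) (fmmap (sub_comp (up_sub (up_sub s))) H) (sub_comp (up_sub s) N)"

abbreviation inst1 :: "'op comp \<Rightarrow> 'op val \<Rightarrow> 'op comp" where
  "inst1 M V \<equiv> sub_comp (case_nat V Var) M"

text \<open>\<open>inst2 M V K\<close> is \<open>M[V/x, K/k]\<close> for the body \<open>M\<close> of a clause \<open>op(x,k) \<mapsto> M\<close>.\<close>

abbreviation inst2 :: "'op comp \<Rightarrow> 'op val \<Rightarrow> 'op val \<Rightarrow> 'op comp" where
  "inst2 M V K \<equiv> sub_comp (case_nat K (case_nat V Var)) M"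


section \<open>Typing\<close>

inductive val_ty :: "'op ctx \<Rightarrow> 'op val \<Rightarrow> 'op ty \<Rightarrow> bool"
      and comp_ty :: "'op ctx \<Rightarrow> 'op comp \<Rightarrow> 'op cty \<Rightarrow> bool"
      and hdl_ty :: "'op ctx \<Rightarrow> 'op hdl \<Rightarrow> 'op sig \<Rightarrow> 'op cty \<Rightarrow> bool" where
  ty_Var: "i < length \<Gamma> \<Longrightarrow> val_ty \<Gamma> (Var i) (\<Gamma> ! i)"
| ty_Lam: "comp_ty (A # \<Gamma>) M C \<Longrightarrow> val_ty \<Gamma> (Lam A M) (Fun A C)"
| ty_Tup: "length Vs = length As \<Longrightarrow> (\<And>i. i < length As \<Longrightarrow> val_ty \<Gamma> (Vs ! i) (As ! i))
    \<Longrightarrow> val_ty \<Gamma> (Tup Vs) (Prod As)"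
| ty_Proj: "val_ty \<Gamma> V (Prod As) \<Longrightarrow> i < length As \<Longrightarrow> val_ty \<Gamma> (Proj i V) (As ! i)"
| ty_App: "val_ty \<Gamma> V (Fun A C) \<Longrightarrow> val_ty \<Gamma> W A \<Longrightarrow> comp_ty \<Gamma> (App V W) C"
| ty_Ret: "val_ty \<Gamma> V A \<Longrightarrow> comp_ty \<Gamma> (Ret \<Sigma> V) (Comp A \<Sigma>)"
| ty_Let: "comp_ty \<Gamma> M (Comp A \<Sigma>) \<Longrightarrow> comp_ty (A # \<Gamma>) N (Comp B \<Sigma>)
    \<Longrightarrow> comp_ty \<Gamma> (LetIn M N) (Comp B \<Sigma>)"
| ty_Op: "fmlookup \<Sigma> op = Some (A, B) \<Longrightarrow> val_ty \<Gamma> V A \<Longrightarrow> comp_ty \<Gamma> (Op \<Sigma> op V) (Comp B \<Sigma>)"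
| ty_Handle: "comp_ty \<Gamma> M (Comp A \<Sigma>) \<Longrightarrow> hdl_ty \<Gamma> H \<Sigma> C \<Longrightarrow> comp_ty (A # \<Gamma>) N C
    \<Longrightarrow> comp_ty \<Gamma> (Handle M H N) C"
| ty_Hdl: "fmdom H = fmdom \<Sigma> \<Longrightarrow>
    (\<And>op A B M. fmlookup \<Sigma> op = Some (A, B) \<Longrightarrow> fmlookup H op = Some M
       \<Longrightarrow> comp_ty (Fun B C # A # \<Gamma>) M C)
    \<Longrightarrow> hdl_ty \<Gamma> H \<Sigma> C"

inductive_cases val_ty_VarE: "val_ty \<Gamma> (Var i) A"
inductive_cases val_ty_LamE: "val_ty \<Gamma> (Lam A' M) A"
inductive_cases val_ty_TupE: "val_ty \<Gamma> (Tup Vs) A"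
inductive_cases val_ty_ProjE: "val_ty \<Gamma> (Proj i V) A"
inductive_cases comp_ty_AppE: "comp_ty \<Gamma> (App V W) C"
inductive_cases comp_ty_RetE: "comp_ty \<Gamma> (Ret \<Sigma> V) C"
inductive_cases comp_ty_LetE: "comp_ty \<Gamma> (LetIn M N) C"
inductive_cases comp_ty_OpE: "comp_ty \<Gamma> (Op \<Sigma> op V) C"
inductive_cases comp_ty_HandleE: "comp_ty \<Gamma> (Handle M H N) C"

lemma unique_typing_aux:
  "val_ty \<Gamma> V A \<Longrightarrow> (\<forall>A'. val_ty \<Gamma> V A' \<longrightarrow> A' = A)"
  "comp_ty \<Gamma> M C \<Longrightarrow> (\<forall>C'. comp_ty \<Gamma> M C' \<longrightarrow> C' = C)"
  "hdl_ty \<Gamma> H \<Sigma> C \<Longrightarrow> True"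
proof (induction rule: val_ty_comp_ty_hdl_ty.inducts)
  case (ty_Var i \<Gamma>)
  show ?case by (metis val_ty_VarE)
next
  case (ty_Lam A \<Gamma> M C)
  then show ?case by (metis val_ty_LamE)
next
  case (ty_Tup Vs As \<Gamma>)
  show ?case
  proof (intro allI impI)
    fix A' assume "val_ty \<Gamma> (Tup Vs) A'"
    then obtain As' where "A' = Prod As'" "length Vs = length As'"
      "\<And>i. i < length As' \<Longrightarrow> val_ty \<Gamma> (Vs ! i) (As' ! i)"
      by (rule val_ty_TupE) (rule that; simp)
    with ty_Tup(1,3) have "As' = As" by (intro nth_equalityI) simp_all
    with \<open>A' = Prod As'\<close> show "A' = Prod As" by simp
  qed
next
  case (ty_Proj \<Gamma> V As i)
  then show ?case by (metis val_ty_ProjE ty.inject(2))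
next
  case (ty_App \<Gamma> V A C W)
  then show ?case by (metis comp_ty_AppE ty.inject(1))
next
  case (ty_Ret \<Gamma> V A \<Sigma>)
  then show ?case by (metis comp_ty_RetE)
next
  case (ty_Let \<Gamma> M A \<Sigma> N B)
  then show ?case by (metis comp_ty_LetE cty.inject)
next
  case (ty_Op \<Sigma> op A B \<Gamma> V)
  then show ?case by (metis comp_ty_OpE option.inject prod.inject)
next
  case (ty_Handle \<Gamma> M A \<Sigma> H C N)
  then show ?case by (metis comp_ty_HandleE cty.inject)
qed simp

lemma unique_typing:
  "val_ty \<Gamma> V A \<Longrightarrow> val_ty \<Gamma> V A' \<Longrightarrow> A' = A"
  "comp_ty \<Gamma> M C \<Longrightarrow> comp_ty \<Gamma> M C' \<Longrightarrow> C' = C"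
  using unique_typing_aux by blast+

definition ty_of_val :: "'op ctx \<Rightarrow> 'op val \<Rightarrow> 'op ty" where
  "ty_of_val \<Gamma> V = (THE A. val_ty \<Gamma> V A)"

definition ty_of_comp :: "'op ctx \<Rightarrow> 'op comp \<Rightarrow> 'op cty" where
  "ty_of_comp \<Gamma> M = (THE C. comp_ty \<Gamma> M C)"


section \<open>Equational theory\<close>

inductive val_eq :: "'op ctx \<Rightarrow> 'op val \<Rightarrow> 'op val \<Rightarrow> 'op ty \<Rightarrow> bool"
      and comp_eq :: "'op ctx \<Rightarrow> 'op comp \<Rightarrow> 'op comp \<Rightarrow> 'op cty \<Rightarrow> bool"
      and hdl_eq :: "'op ctx \<Rightarrow> 'op hdl \<Rightarrow> 'op hdl \<Rightarrow> 'op sig \<Rightarrow> 'op cty \<Rightarrow> bool" where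
  val_refl: "val_ty \<Gamma> V A \<Longrightarrow> val_eq \<Gamma> V V A"
| val_sym: "val_eq \<Gamma> V W A \<Longrightarrow> val_eq \<Gamma> W V A"
| val_trans: "val_eq \<Gamma> U V A \<Longrightarrow> val_eq \<Gamma> V W A \<Longrightarrow> val_eq \<Gamma> U W A"
| comp_refl: "comp_ty \<Gamma> M C \<Longrightarrow> comp_eq \<Gamma> M M C"
| comp_sym: "comp_eq \<Gamma> M N C \<Longrightarrow> comp_eq \<Gamma> N M C"
| comp_trans: "comp_eq \<Gamma> L M C \<Longrightarrow> comp_eq \<Gamma> M N C \<Longrightarrow> comp_eq \<Gamma> L N C"
| hdl_refl: "hdl_ty \<Gamma> H \<Sigma> C \<Longrightarrow> hdl_eq \<Gamma> H H \<Sigma> C"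
| hdl_sym: "hdl_eq \<Gamma> H H' \<Sigma> C \<Longrightarrow> hdl_eq \<Gamma> H' H \<Sigma> C"
| hdl_trans: "hdl_eq \<Gamma> H H' \<Sigma> C \<Longrightarrow> hdl_eq \<Gamma> H' H'' \<Sigma> C \<Longrightarrow> hdl_eq \<Gamma> H H'' \<Sigma> C"

| cong_Lam: "comp_eq (A # \<Gamma>) M M' C \<Longrightarrow> val_eq \<Gamma> (Lam A M) (Lam A M') (Fun A C)"
| cong_Tup: "length Vs = length As \<Longrightarrow> length Vs' = length As \<Longrightarrow>
    (\<And>i. i < length As \<Longrightarrow> val_eq \<Gamma> (Vs ! i) (Vs' ! i) (As ! i))
    \<Longrightarrow> val_eq \<Gamma> (Tup Vs) (Tup Vs') (Prod As)"
| cong_Proj: "val_eq \<Gamma> V V' (Prod As) \<Longrightarrow> i < length As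
    \<Longrightarrow> val_eq \<Gamma> (Proj i V) (Proj i V') (As ! i)"
| cong_App: "val_eq \<Gamma> V V' (Fun A C) \<Longrightarrow> val_eq \<Gamma> W W' A
    \<Longrightarrow> comp_eq \<Gamma> (App V W) (App V' W') C"
| cong_Ret: "val_eq \<Gamma> V V' A \<Longrightarrow> comp_eq \<Gamma> (Ret \<Sigma> V) (Ret \<Sigma> V') (Comp A \<Sigma>)"
| cong_Let: "comp_eq \<Gamma> M M' (Comp A \<Sigma>) \<Longrightarrow> comp_eq (A # \<Gamma>) N N' (Comp B \<Sigma>)
    \<Longrightarrow> comp_eq \<Gamma> (LetIn M N) (LetIn M' N') (Comp B \<Sigma>)"
| cong_Op: "fmlookup \<Sigma> op = Some (A, B) \<Longrightarrow> val_eq \<Gamma> V V' A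
    \<Longrightarrow> comp_eq \<Gamma> (Op \<Sigma> op V) (Op \<Sigma> op V') (Comp B \<Sigma>)"
| cong_Handle: "comp_eq \<Gamma> M M' (Comp A \<Sigma>) \<Longrightarrow> hdl_eq \<Gamma> H H' \<Sigma> C \<Longrightarrow> comp_eq (A # \<Gamma>) N N' C
    \<Longrightarrow> comp_eq \<Gamma> (Handle M H N) (Handle M' H' N') C"
| cong_Hdl: "fmdom H = fmdom \<Sigma> \<Longrightarrow> fmdom H' = fmdom \<Sigma> \<Longrightarrow>
    (\<And>op A B M M'. fmlookup \<Sigma> op = Some (A, B) \<Longrightarrow> fmlookup H op = Some M
       \<Longrightarrow> fmlookup H' op = Some M' \<Longrightarrow> comp_eq (Fun B C # A # \<Gamma>) M M' C)
    \<Longrightarrow> hdl_eq \<Gamma> H H' \<Sigma> C"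

| beta_Fun: "comp_ty (A # \<Gamma>) M C \<Longrightarrow> val_ty \<Gamma> V A \<Longrightarrow> comp_eq \<Gamma> (App (Lam A M) V) (inst1 M V) C"
| eta_Fun: "val_ty \<Gamma> V (Fun A C)
    \<Longrightarrow> val_eq \<Gamma> V (Lam A (App (ren_val Suc V) (Var 0))) (Fun A C)"
| beta_Prod: "val_ty \<Gamma> (Tup Vs) (Prod As) \<Longrightarrow> i < length As
    \<Longrightarrow> val_eq \<Gamma> (Proj i (Tup Vs)) (Vs ! i) (As ! i)"
| eta_Prod: "val_ty \<Gamma> V (Prod As)
    \<Longrightarrow> val_eq \<Gamma> V (Tup (map (\<lambda>i. Proj i V) [0..<length As])) (Prod As)"

| let_ret: "val_ty \<Gamma> V A \<Longrightarrow> comp_ty (A # \<Gamma>) M (Comp B \<Sigma>)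
    \<Longrightarrow> comp_eq \<Gamma> (LetIn (Ret \<Sigma> V) M) (inst1 M V) (Comp B \<Sigma>)"
| ret_let: "comp_ty \<Gamma> M (Comp A \<Sigma>) \<Longrightarrow> comp_eq \<Gamma> (LetIn M (Ret \<Sigma> (Var 0))) M (Comp A \<Sigma>)"
| let_let: "comp_ty \<Gamma> L (Comp A \<Sigma>) \<Longrightarrow> comp_ty (A # \<Gamma>) M (Comp B \<Sigma>) \<Longrightarrow>
    comp_ty (B # \<Gamma>) N (Comp D \<Sigma>) \<Longrightarrow>
    comp_eq \<Gamma> (LetIn (LetIn L M) N) (LetIn L (LetIn M (ren_comp (up_ren Suc) N))) (Comp D \<Sigma>)"

| handle_ret: "val_ty \<Gamma> V A \<Longrightarrow> hdl_ty \<Gamma> H \<Sigma> C \<Longrightarrow> comp_ty (A # \<Gamma>) M C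
    \<Longrightarrow> comp_eq \<Gamma> (Handle (Ret \<Sigma> V) H M) (inst1 M V) C"
| handle_let: "comp_ty \<Gamma> L (Comp A \<Sigma>) \<Longrightarrow> comp_ty (A # \<Gamma>) M (Comp B \<Sigma>) \<Longrightarrow>
    hdl_ty \<Gamma> H \<Sigma> C \<Longrightarrow> comp_ty (B # \<Gamma>) N C \<Longrightarrow>
    comp_eq \<Gamma> (Handle (LetIn L M) H N)
      (Handle L H (Handle M (ren_hdl Suc H) (ren_comp (up_ren Suc) N))) C"
| handle_op: "fmlookup \<Sigma> op = Some (A, B) \<Longrightarrow> val_ty \<Gamma> V A \<Longrightarrow> hdl_ty \<Gamma> H \<Sigma> C \<Longrightarrow>
    fmlookup H op = Some N \<Longrightarrow> comp_ty (B # \<Gamma>) M C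
    \<Longrightarrow> comp_eq \<Gamma> (Handle (Op \<Sigma> op V) H M) (inst2 N V (Lam B M)) C"


section \<open>Cartesian categories, strong monads and Kleisli exponentials\<close>

text \<open>The objects of a category are all elements of \<open>'o\<close>, its morphisms all elements of \<open>'m\<close>.\<close>

record ('o, 'm) cat =
  Dom :: "'m \<Rightarrow> 'o"
  Cod :: "'m \<Rightarrow> 'o"
  Id :: "'o \<Rightarrow> 'm"
  Cmp :: "'m \<Rightarrow> 'm \<Rightarrow> 'm" (infixl "\<cdot>\<index>" 70)

definition hom :: "('o, 'm, 'z) cat_scheme \<Rightarrow> 'o \<Rightarrow> 'o \<Rightarrow> 'm set" where
  "hom \<C> X Y = {f. Dom \<C> f = X \<and> Cod \<C> f = Y}"

definition category :: "('o, 'm, 'z) cat_scheme \<Rightarrow> bool" where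
  "category \<C> \<longleftrightarrow>
     (\<forall>X. Id \<C> X \<in> hom \<C> X X) \<and>
     (\<forall>X Y Z f g. f \<in> hom \<C> X Y \<longrightarrow> g \<in> hom \<C> Y Z \<longrightarrow> g \<cdot>\<^bsub>\<C>\<^esub> f \<in> hom \<C> X Z) \<and>
     (\<forall>X Y f. f \<in> hom \<C> X Y \<longrightarrow> f \<cdot>\<^bsub>\<C>\<^esub> Id \<C> X = f \<and> Id \<C> Y \<cdot>\<^bsub>\<C>\<^esub> f = f) \<and>
     (\<forall>W X Y Z f g h. f \<in> hom \<C> W X \<longrightarrow> g \<in> hom \<C> X Y \<longrightarrow> h \<in> hom \<C> Y Z \<longrightarrow>
        h \<cdot>\<^bsub>\<C>\<^esub> (g \<cdot>\<^bsub>\<C>\<^esub> f) = (h \<cdot>\<^bsub>\<C>\<^esub> g) \<cdot>\<^bsub>\<C>\<^esub> f)"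

definition is_product ::
  "('o, 'm, 'z) cat_scheme \<Rightarrow> 'i set \<Rightarrow> ('i \<Rightarrow> 'o) \<Rightarrow> 'o \<Rightarrow> ('i \<Rightarrow> 'm) \<Rightarrow> bool" where
  "is_product \<C> I X P p \<longleftrightarrow>
     (\<forall>i\<in>I. p i \<in> hom \<C> P (X i)) \<and>
     (\<forall>Z f. (\<forall>i\<in>I. f i \<in> hom \<C> Z (X i)) \<longrightarrow>
        (\<exists>!h. h \<in> hom \<C> Z P \<and> (\<forall>i\<in>I. p i \<cdot>\<^bsub>\<C>\<^esub> h = f i)))"

definition mediating ::
  "('o, 'm, 'z) cat_scheme \<Rightarrow> 'i set \<Rightarrow> 'o \<Rightarrow> ('i \<Rightarrow> 'm) \<Rightarrow> 'o \<Rightarrow> ('i \<Rightarrow> 'm) \<Rightarrow> 'm" where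
  "mediating \<C> I P p Z f = (THE h. h \<in> hom \<C> Z P \<and> (\<forall>i\<in>I. p i \<cdot>\<^bsub>\<C>\<^esub> h = f i))"

text \<open>
  Chosen finite products, both of finite sequences of objects and of families indexed by a finite
  set of operation symbols; the latter are the products over the entries of a signature.
\<close>

record ('op, 'o, 'm) cart = "('o, 'm) cat" +
  Prd :: "'o list \<Rightarrow> 'o"
  Prj :: "'o list \<Rightarrow> nat \<Rightarrow> 'm"
  OpPrd :: "('op, 'o) fmap \<Rightarrow> 'o"
  OpPrj :: "('op, 'o) fmap \<Rightarrow> 'op \<Rightarrow> 'm"

definition cartesian :: "('op, 'o, 'm, 'z) cart_scheme \<Rightarrow> bool" where
  "cartesian \<C> \<longleftrightarrow> category \<C> \<and>
     (\<forall>Xs. is_product \<C> {..<length Xs} (\<lambda>i. Xs ! i) (Prd \<C> Xs) (Prj \<C> Xs)) \<and>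
     (\<forall>F. is_product \<C> (fset (fmdom F)) (\<lambda>op. the (fmlookup F op)) (OpPrd \<C> F) (OpPrj \<C> F))"

definition tuple :: "('op, 'o, 'm, 'z) cart_scheme \<Rightarrow> 'o \<Rightarrow> 'm list \<Rightarrow> 'm" where
  "tuple \<C> Z fs = (let Xs = map (Cod \<C>) fs in
     mediating \<C> {..<length fs} (Prd \<C> Xs) (Prj \<C> Xs) Z (\<lambda>i. fs ! i))"

definition op_tuple :: "('op, 'o, 'm, 'z) cart_scheme \<Rightarrow> 'o \<Rightarrow> ('op, 'm) fmap \<Rightarrow> 'm" where
  "op_tuple \<C> Z fs = (let F = fmmap (Cod \<C>) fs in
     mediating \<C> (fset (fmdom fs)) (OpPrd \<C> F) (OpPrj \<C> F) Z (\<lambda>op. the (fmlookup fs op)))"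

abbreviation terminal :: "('op, 'o, 'm, 'z) cart_scheme \<Rightarrow> 'o" where
  "terminal \<C> \<equiv> Prd \<C> []"

abbreviation bprod :: "('op, 'o, 'm, 'z) cart_scheme \<Rightarrow> 'o \<Rightarrow> 'o \<Rightarrow> 'o" where
  "bprod \<C> X Y \<equiv> Prd \<C> [X, Y]"

abbreviation pr1 :: "('op, 'o, 'm, 'z) cart_scheme \<Rightarrow> 'o \<Rightarrow> 'o \<Rightarrow> 'm" where
  "pr1 \<C> X Y \<equiv> Prj \<C> [X, Y] 0"

abbreviation pr2 :: "('op, 'o, 'm, 'z) cart_scheme \<Rightarrow> 'o \<Rightarrow> 'o \<Rightarrow> 'm" where
  "pr2 \<C> X Y \<equiv> Prj \<C> [X, Y] (Suc 0)"

definition pair :: "('op, 'o, 'm, 'z) cart_scheme \<Rightarrow> 'm \<Rightarrow> 'm \<Rightarrow> 'm" where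
  "pair \<C> f g = tuple \<C> (Dom \<C> f) [f, g]"

definition prod_map :: "('op, 'o, 'm, 'z) cart_scheme \<Rightarrow> 'm \<Rightarrow> 'm \<Rightarrow> 'm" where
  "prod_map \<C> f g = pair \<C> (f \<cdot>\<^bsub>\<C>\<^esub> pr1 \<C> (Dom \<C> f) (Dom \<C> g)) (g \<cdot>\<^bsub>\<C>\<^esub> pr2 \<C> (Dom \<C> f) (Dom \<C> g))"

definition swap :: "('op, 'o, 'm, 'z) cart_scheme \<Rightarrow> 'o \<Rightarrow> 'o \<Rightarrow> 'm" where
  "swap \<C> X Y = pair \<C> (pr2 \<C> X Y) (pr1 \<C> X Y)"

text \<open>\<open>assoc \<C> X Y Z\<close> is the canonical isomorphism from \<open>(X \<times> Y) \<times> Z\<close> to \<open>X \<times> (Y \<times> Z)\<close>,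
  \<open>assoc_inv \<C> X Y Z\<close> its inverse.\<close>

definition assoc :: "('op, 'o, 'm, 'z) cart_scheme \<Rightarrow> 'o \<Rightarrow> 'o \<Rightarrow> 'o \<Rightarrow> 'm" where
  "assoc \<C> X Y Z = (let p = pr1 \<C> (bprod \<C> X Y) Z in
     pair \<C> (pr1 \<C> X Y \<cdot>\<^bsub>\<C>\<^esub> p) (pair \<C> (pr2 \<C> X Y \<cdot>\<^bsub>\<C>\<^esub> p) (pr2 \<C> (bprod \<C> X Y) Z)))"

definition assoc_inv :: "('op, 'o, 'm, 'z) cart_scheme \<Rightarrow> 'o \<Rightarrow> 'o \<Rightarrow> 'o \<Rightarrow> 'm" where
  "assoc_inv \<C> X Y Z = (let q = pr2 \<C> X (bprod \<C> Y Z) in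
     pair \<C> (pair \<C> (pr1 \<C> X (bprod \<C> Y Z)) (pr1 \<C> Y Z \<cdot>\<^bsub>\<C>\<^esub> q)) (pr2 \<C> Y Z \<cdot>\<^bsub>\<C>\<^esub> q))"

record ('o, 'm) monad =
  Ob :: "'o \<Rightarrow> 'o"
  Map :: "'m \<Rightarrow> 'm"
  Eta :: "'o \<Rightarrow> 'm"
  Mu :: "'o \<Rightarrow> 'm"
  St :: "'o \<Rightarrow> 'o \<Rightarrow> 'm"

definition monad :: "('o, 'm, 'z) cat_scheme \<Rightarrow> ('o, 'm) monad \<Rightarrow> bool" where
  "monad \<C> T \<longleftrightarrow>
     (\<forall>X Y f. f \<in> hom \<C> X Y \<longrightarrow> Map T f \<in> hom \<C> (Ob T X) (Ob T Y)) \<and>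
     (\<forall>X. Map T (Id \<C> X) = Id \<C> (Ob T X)) \<and>
     (\<forall>X Y Z f g. f \<in> hom \<C> X Y \<longrightarrow> g \<in> hom \<C> Y Z \<longrightarrow>
        Map T (g \<cdot>\<^bsub>\<C>\<^esub> f) = Map T g \<cdot>\<^bsub>\<C>\<^esub> Map T f) \<and>
     (\<forall>X. Eta T X \<in> hom \<C> X (Ob T X)) \<and>
     (\<forall>X Y f. f \<in> hom \<C> X Y \<longrightarrow> Map T f \<cdot>\<^bsub>\<C>\<^esub> Eta T X = Eta T Y \<cdot>\<^bsub>\<C>\<^esub> f) \<and>
     (\<forall>X. Mu T X \<in> hom \<C> (Ob T (Ob T X)) (Ob T X)) \<and>
     (\<forall>X Y f. f \<in> hom \<C> X Y \<longrightarrow>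
        Map T f \<cdot>\<^bsub>\<C>\<^esub> Mu T X = Mu T Y \<cdot>\<^bsub>\<C>\<^esub> Map T (Map T f)) \<and>
     (\<forall>X. Mu T X \<cdot>\<^bsub>\<C>\<^esub> Eta T (Ob T X) = Id \<C> (Ob T X)) \<and>
     (\<forall>X. Mu T X \<cdot>\<^bsub>\<C>\<^esub> Map T (Eta T X) = Id \<C> (Ob T X)) \<and>
     (\<forall>X. Mu T X \<cdot>\<^bsub>\<C>\<^esub> Mu T (Ob T X) = Mu T X \<cdot>\<^bsub>\<C>\<^esub> Map T (Mu T X))"

definition strong_monad :: "('op, 'o, 'm, 'z) cart_scheme \<Rightarrow> ('o, 'm) monad \<Rightarrow> bool" where
  "strong_monad \<C> T \<longleftrightarrow> monad \<C> T \<and>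
     (\<forall>X Y. St T X Y \<in> hom \<C> (bprod \<C> X (Ob T Y)) (Ob T (bprod \<C> X Y))) \<and>
     (\<forall>X X' Y Y' f g. f \<in> hom \<C> X X' \<longrightarrow> g \<in> hom \<C> Y Y' \<longrightarrow>
        Map T (prod_map \<C> f g) \<cdot>\<^bsub>\<C>\<^esub> St T X Y = St T X' Y' \<cdot>\<^bsub>\<C>\<^esub> prod_map \<C> f (Map T g)) \<and>
     (\<forall>X. Map T (pr2 \<C> (terminal \<C>) X) \<cdot>\<^bsub>\<C>\<^esub> St T (terminal \<C>) X =
        pr2 \<C> (terminal \<C>) (Ob T X)) \<and>
     (\<forall>X Y Z. Map T (assoc \<C> X Y Z) \<cdot>\<^bsub>\<C>\<^esub> St T (bprod \<C> X Y) Z =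
        St T X (bprod \<C> Y Z) \<cdot>\<^bsub>\<C>\<^esub> prod_map \<C> (Id \<C> X) (St T Y Z) \<cdot>\<^bsub>\<C>\<^esub> assoc \<C> X Y (Ob T Z)) \<and>
     (\<forall>X Y. St T X Y \<cdot>\<^bsub>\<C>\<^esub> prod_map \<C> (Id \<C> X) (Eta T Y) = Eta T (bprod \<C> X Y)) \<and>
     (\<forall>X Y. St T X Y \<cdot>\<^bsub>\<C>\<^esub> prod_map \<C> (Id \<C> X) (Mu T Y) =
        Mu T (bprod \<C> X Y) \<cdot>\<^bsub>\<C>\<^esub> Map T (St T X Y) \<cdot>\<^bsub>\<C>\<^esub> St T X (Ob T Y))"

text \<open>The morphisms of the Kleisli category; the left adjoint \<open>J\<close> is the identity on objects.\<close>

definition kl_hom :: "('o, 'm, 'z) cat_scheme \<Rightarrow> ('o, 'm) monad \<Rightarrow> 'o \<Rightarrow> 'o \<Rightarrow> 'm set" where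
  "kl_hom \<C> T X Y = hom \<C> X (Ob T Y)"

record ('o, 'm) kexp =
  Exp :: "'o \<Rightarrow> 'o \<Rightarrow> 'o"
  Cur :: "'o \<Rightarrow> 'o \<Rightarrow> 'o \<Rightarrow> 'm \<Rightarrow> 'm"

text \<open>
  The bijections are natural in \<open>X\<close>. Kleisli composition with the image under \<open>J\<close> of
  \<open>g \<times> id\<close> is plain composition with \<open>g \<times> id\<close>.
\<close>

definition kleisli_exponentials ::
  "('op, 'o, 'm, 'z) cart_scheme \<Rightarrow> ('o, 'm) monad \<Rightarrow> ('o, 'm) kexp \<Rightarrow> bool" where
  "kleisli_exponentials \<C> T E \<longleftrightarrow>
     (\<forall>X Y Z. bij_betw (Cur E X Y Z) (kl_hom \<C> T (bprod \<C> X Y) Z) (hom \<C> X (Exp E Y Z))) \<and>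
     (\<forall>X X' Y Z f g. g \<in> hom \<C> X' X \<longrightarrow> f \<in> kl_hom \<C> T (bprod \<C> X Y) Z \<longrightarrow>
        Cur E X' Y Z (f \<cdot>\<^bsub>\<C>\<^esub> prod_map \<C> g (Id \<C> Y)) = Cur E X Y Z f \<cdot>\<^bsub>\<C>\<^esub> g)"

definition Ev ::
  "('op, 'o, 'm, 'z) cart_scheme \<Rightarrow> ('o, 'm) monad \<Rightarrow> ('o, 'm) kexp \<Rightarrow> 'o \<Rightarrow> 'o \<Rightarrow> 'm" where
  "Ev \<C> T E Y Z = the_inv_into (kl_hom \<C> T (bprod \<C> (Exp E Y Z) Y) Z)
     (Cur E (Exp E Y Z) Y Z) (Id \<C> (Exp E Y Z))"


section \<open>Models\<close>

type_synonym ('op, 'o) sem_sig = "('op, 'o \<times> 'o) fmap"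

record ('op, 'o, 'm) model = "('op, 'o, 'm) cart" +
  Mon :: "('op, 'o) sem_sig \<Rightarrow> ('o, 'm) monad"
  KExp :: "('op, 'o) sem_sig \<Rightarrow> ('o, 'm) kexp"
  OpMor :: "('op, 'o) sem_sig \<Rightarrow> 'op \<Rightarrow> 'm"
  Hnd :: "('op, 'o) sem_sig \<Rightarrow> ('op, 'o) sem_sig \<Rightarrow> 'o \<Rightarrow> 'm"

abbreviation TOb :: "('op, 'o, 'm) model \<Rightarrow> ('op, 'o) sem_sig \<Rightarrow> 'o \<Rightarrow> 'o" where
  "TOb \<M> S \<equiv> Ob (Mon \<M> S)"

abbreviation TMap :: "('op, 'o, 'm) model \<Rightarrow> ('op, 'o) sem_sig \<Rightarrow> 'm \<Rightarrow> 'm" where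
  "TMap \<M> S \<equiv> Map (Mon \<M> S)"

abbreviation eta :: "('op, 'o, 'm) model \<Rightarrow> ('op, 'o) sem_sig \<Rightarrow> 'o \<Rightarrow> 'm" where
  "eta \<M> S \<equiv> Eta (Mon \<M> S)"

abbreviation mu :: "('op, 'o, 'm) model \<Rightarrow> ('op, 'o) sem_sig \<Rightarrow> 'o \<Rightarrow> 'm" where
  "mu \<M> S \<equiv> Mu (Mon \<M> S)"

abbreviation st :: "('op, 'o, 'm) model \<Rightarrow> ('op, 'o) sem_sig \<Rightarrow> 'o \<Rightarrow> 'o \<Rightarrow> 'm" where
  "st \<M> S \<equiv> St (Mon \<M> S)"

abbreviation texp :: "('op, 'o, 'm) model \<Rightarrow> ('op, 'o) sem_sig \<Rightarrow> 'o \<Rightarrow> 'o \<Rightarrow> 'o" where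
  "texp \<M> S \<equiv> Exp (KExp \<M> S)"

abbreviation cur :: "('op, 'o, 'm) model \<Rightarrow> ('op, 'o) sem_sig \<Rightarrow> 'o \<Rightarrow> 'o \<Rightarrow> 'o \<Rightarrow> 'm \<Rightarrow> 'm" where
  "cur \<M> S \<equiv> Cur (KExp \<M> S)"

abbreviation ev :: "('op, 'o, 'm) model \<Rightarrow> ('op, 'o) sem_sig \<Rightarrow> 'o \<Rightarrow> 'o \<Rightarrow> 'm" where
  "ev \<M> S \<equiv> Ev \<M> (Mon \<M> S) (KExp \<M> S)"

definition hfam ::
  "('op, 'o, 'm) model \<Rightarrow> ('op, 'o) sem_sig \<Rightarrow> ('op, 'o) sem_sig \<Rightarrow> 'o \<Rightarrow> ('op, 'o) fmap" where
  "hfam \<M> S S' X = fmmap (\<lambda>(A, B). texp \<M> S' (bprod \<M> A (texp \<M> S' B X)) X) S"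

text \<open>\<open>hobj \<M> S S' X\<close> is the object \<open>H\<^sub>S(X)\<close> built from the monad for \<open>S'\<close>.\<close>

definition hobj ::
  "('op, 'o, 'm) model \<Rightarrow> ('op, 'o) sem_sig \<Rightarrow> ('op, 'o) sem_sig \<Rightarrow> 'o \<Rightarrow> 'o" where
  "hobj \<M> S S' X = OpPrd \<M> (hfam \<M> S S' X)"

definition hprj ::
  "('op, 'o, 'm) model \<Rightarrow> ('op, 'o) sem_sig \<Rightarrow> ('op, 'o) sem_sig \<Rightarrow> 'o \<Rightarrow> 'op \<Rightarrow> 'm" where
  "hprj \<M> S S' X = OpPrj \<M> (hfam \<M> S S' X)"

text \<open>The morphism \<open>a\<^sub>o\<^sub>p\<close>, for an entry \<open>op : A \<rightarrow> B\<close> of \<open>S\<close>.\<close>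

definition aop ::
  "('op, 'o, 'm) model \<Rightarrow> ('op, 'o) sem_sig \<Rightarrow> ('op, 'o) sem_sig \<Rightarrow> 'o \<Rightarrow> 'op \<Rightarrow> 'o \<Rightarrow> 'm" where
  "aop \<M> S S' X op B = (let K = texp \<M> S' B X in
     TMap \<M> S (ev \<M> S' B X) \<cdot>\<^bsub>\<M>\<^esub> st \<M> S K B \<cdot>\<^bsub>\<M>\<^esub> swap \<M> (TOb \<M> S B) K
       \<cdot>\<^bsub>\<M>\<^esub> prod_map \<M> (OpMor \<M> S op) (Id \<M> K))"

definition lambda_eff_model :: "('op, 'o, 'm) model \<Rightarrow> bool" where
  "lambda_eff_model \<M> \<longleftrightarrow> cartesian \<M> \<and>
     (\<forall>S. strong_monad \<M> (Mon \<M> S)) \<and>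
     (\<forall>S. kleisli_exponentials \<M> (Mon \<M> S) (KExp \<M> S)) \<and>
     (\<forall>S op A B. fmlookup S op = Some (A, B) \<longrightarrow> OpMor \<M> S op \<in> hom \<M> A (TOb \<M> S B)) \<and>
     (\<forall>S S' X. Hnd \<M> S S' X \<in>
        hom \<M> (bprod \<M> (hobj \<M> S S' X) (TOb \<M> S (TOb \<M> S' X))) (TOb \<M> S' X)) \<and>
     (\<forall>S S' X. Hnd \<M> S S' X \<cdot>\<^bsub>\<M>\<^esub> prod_map \<M> (Id \<M> (hobj \<M> S S' X)) (eta \<M> S (TOb \<M> S' X)) =
        pr2 \<M> (hobj \<M> S S' X) (TOb \<M> S' X)) \<and>
     (\<forall>S S' X. let H = hobj \<M> S S' X; Y = TOb \<M> S (TOb \<M> S' X) in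
        Hnd \<M> S S' X \<cdot>\<^bsub>\<M>\<^esub> prod_map \<M> (Id \<M> H) (mu \<M> S (TOb \<M> S' X)) =
        Hnd \<M> S S' X \<cdot>\<^bsub>\<M>\<^esub> prod_map \<M> (Id \<M> H) (TMap \<M> S (Hnd \<M> S S' X))
          \<cdot>\<^bsub>\<M>\<^esub> pair \<M> (pr1 \<M> H (TOb \<M> S Y)) (st \<M> S H Y)) \<and>
     (\<forall>S S' X op A B. fmlookup S op = Some (A, B) \<longrightarrow>
        Hnd \<M> S S' X \<cdot>\<^bsub>\<M>\<^esub> prod_map \<M> (Id \<M> (hobj \<M> S S' X)) (aop \<M> S S' X op B) =
        ev \<M> S' (bprod \<M> A (texp \<M> S' B X)) X
          \<cdot>\<^bsub>\<M>\<^esub> prod_map \<M> (hprj \<M> S S' X op) (Id \<M> (bprod \<M> A (texp \<M> S' B X))))"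


section \<open>Interpretation\<close>

text \<open>A computation type \<open>A!\<Sigma>\<close> denotes the pair of the denotations of \<open>\<Sigma>\<close> and of \<open>A\<close>.\<close>

primrec sem_ty :: "('op, 'o, 'm) model \<Rightarrow> 'op ty \<Rightarrow> 'o"
    and sem_cty :: "('op, 'o, 'm) model \<Rightarrow> 'op cty \<Rightarrow> ('op, 'o) sem_sig \<times> 'o" where
  "sem_ty \<M> (Fun A C) = texp \<M> (fst (sem_cty \<M> C)) (sem_ty \<M> A) (snd (sem_cty \<M> C))"
| "sem_ty \<M> (Prod As) = Prd \<M> (map (sem_ty \<M>) As)"
| "sem_cty \<M> (Comp A \<Sigma>) = (fmmap (map_prod (sem_ty \<M>) (sem_ty \<M>)) \<Sigma>, sem_ty \<M> A)"

definition sem_sig :: "('op, 'o, 'm) model \<Rightarrow> 'op sig \<Rightarrow> ('op, 'o) sem_sig" where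
  "sem_sig \<M> \<Sigma> = fmmap (map_prod (sem_ty \<M>) (sem_ty \<M>)) \<Sigma>"

primrec sem_ctx :: "('op, 'o, 'm) model \<Rightarrow> 'op ctx \<Rightarrow> 'o" where
  "sem_ctx \<M> [] = terminal \<M>"
| "sem_ctx \<M> (A # \<Gamma>) = bprod \<M> (sem_ctx \<M> \<Gamma>) (sem_ty \<M> A)"

primrec sem_var :: "('op, 'o, 'm) model \<Rightarrow> 'op ctx \<Rightarrow> nat \<Rightarrow> 'm" where
  "sem_var \<M> [] i = undefined"
| "sem_var \<M> (A # \<Gamma>) i = (case i of
       0 \<Rightarrow> pr2 \<M> (sem_ctx \<M> \<Gamma>) (sem_ty \<M> A)
     | Suc j \<Rightarrow> sem_var \<M> \<Gamma> j \<cdot>\<^bsub>\<M>\<^esub> pr1 \<M> (sem_ctx \<M> \<Gamma>) (sem_ty \<M> A))"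

text \<open>
  The denotation of a handler of type \<open>\<Sigma> \<Rightarrow> C\<close>, given for each clause its denotation as a function
  of the context. The body of a clause for \<open>op : A \<rightarrow> B\<close> denotes a morphism with domain
  \<open>(\<Gamma> \<times> A) \<times> (B \<Rightarrow> X)\<close>, which is reassociated before currying.
\<close>

definition hdl_tuple ::
  "('op, 'o, 'm) model \<Rightarrow> 'op ctx \<Rightarrow> 'op sig \<Rightarrow> 'op cty \<Rightarrow> ('op, 'op ctx \<Rightarrow> 'm) fmap \<Rightarrow> 'm" where
  "hdl_tuple \<M> \<Gamma> \<Sigma> C D = (case sem_cty \<M> C of (S', X) \<Rightarrow>
     op_tuple \<M> (sem_ctx \<M> \<Gamma>) (fmmap_keys (\<lambda>op d. case the (fmlookup \<Sigma> op) of (A, B) \<Rightarrow>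
       let G = sem_ctx \<M> \<Gamma>; a = sem_ty \<M> A; k = sem_ty \<M> (Fun B C)
       in cur \<M> S' G (bprod \<M> a k) X (d (Fun B C # A # \<Gamma>) \<cdot>\<^bsub>\<M>\<^esub> assoc_inv \<M> G a k)) D))"

primrec sem_val :: "('op, 'o, 'm) model \<Rightarrow> 'op val \<Rightarrow> 'op ctx \<Rightarrow> 'm"
    and sem_comp :: "('op, 'o, 'm) model \<Rightarrow> 'op comp \<Rightarrow> 'op ctx \<Rightarrow> 'm" where
  "sem_val \<M> (Var i) \<Gamma> = sem_var \<M> \<Gamma> i"
| "sem_val \<M> (Lam A M) \<Gamma> = (case ty_of_comp (A # \<Gamma>) M of Comp B \<Sigma> \<Rightarrow>
     cur \<M> (sem_sig \<M> \<Sigma>) (sem_ctx \<M> \<Gamma>) (sem_ty \<M> A) (sem_ty \<M> B) (sem_comp \<M> M (A # \<Gamma>)))"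
| "sem_val \<M> (Tup Vs) \<Gamma> = tuple \<M> (sem_ctx \<M> \<Gamma>) (map (\<lambda>V. sem_val \<M> V \<Gamma>) Vs)"
| "sem_val \<M> (Proj i V) \<Gamma> = (case ty_of_val \<Gamma> V of
       Prod As \<Rightarrow> Prj \<M> (map (sem_ty \<M>) As) i \<cdot>\<^bsub>\<M>\<^esub> sem_val \<M> V \<Gamma>
     | _ \<Rightarrow> undefined)"
| "sem_comp \<M> (App V W) \<Gamma> = (case ty_of_val \<Gamma> V of
       Fun A (Comp B \<Sigma>) \<Rightarrow> ev \<M> (sem_sig \<M> \<Sigma>) (sem_ty \<M> A) (sem_ty \<M> B)
         \<cdot>\<^bsub>\<M>\<^esub> pair \<M> (sem_val \<M> V \<Gamma>) (sem_val \<M> W \<Gamma>)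
     | _ \<Rightarrow> undefined)"
| "sem_comp \<M> (Ret \<Sigma> V) \<Gamma> =
     eta \<M> (sem_sig \<M> \<Sigma>) (sem_ty \<M> (ty_of_val \<Gamma> V)) \<cdot>\<^bsub>\<M>\<^esub> sem_val \<M> V \<Gamma>"
| "sem_comp \<M> (LetIn M N) \<Gamma> = (case ty_of_comp \<Gamma> M of Comp A \<Sigma> \<Rightarrow>
     case ty_of_comp (A # \<Gamma>) N of Comp B _ \<Rightarrow>
     let S = sem_sig \<M> \<Sigma>; G = sem_ctx \<M> \<Gamma> in
       mu \<M> S (sem_ty \<M> B) \<cdot>\<^bsub>\<M>\<^esub> TMap \<M> S (sem_comp \<M> N (A # \<Gamma>))
         \<cdot>\<^bsub>\<M>\<^esub> st \<M> S G (sem_ty \<M> A) \<cdot>\<^bsub>\<M>\<^esub> pair \<M> (Id \<M> G) (sem_comp \<M> M \<Gamma>))"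
| "sem_comp \<M> (Op \<Sigma> op V) \<Gamma> = OpMor \<M> (sem_sig \<M> \<Sigma>) op \<cdot>\<^bsub>\<M>\<^esub> sem_val \<M> V \<Gamma>"
| "sem_comp \<M> (Handle M H N) \<Gamma> = (case ty_of_comp \<Gamma> M of Comp A \<Sigma> \<Rightarrow>
     case ty_of_comp (A # \<Gamma>) N of Comp B \<Sigma>' \<Rightarrow>
     let S = sem_sig \<M> \<Sigma>; S' = sem_sig \<M> \<Sigma>'; G = sem_ctx \<M> \<Gamma> in
       Hnd \<M> S S' (sem_ty \<M> B)
         \<cdot>\<^bsub>\<M>\<^esub> pair \<M> (hdl_tuple \<M> \<Gamma> \<Sigma> (Comp B \<Sigma>') (fmmap (sem_comp \<M>) H))
             (TMap \<M> S (sem_comp \<M> N (A # \<Gamma>))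
               \<cdot>\<^bsub>\<M>\<^esub> st \<M> S G (sem_ty \<M> A) \<cdot>\<^bsub>\<M>\<^esub> pair \<M> (Id \<M> G) (sem_comp \<M> M \<Gamma>)))"

definition sem_hdl :: "('op, 'o, 'm) model \<Rightarrow> 'op hdl \<Rightarrow> 'op ctx \<Rightarrow> 'op sig \<Rightarrow> 'op cty \<Rightarrow> 'm" where
  "sem_hdl \<M> H \<Gamma> \<Sigma> C = hdl_tuple \<M> \<Gamma> \<Sigma> C (fmmap (sem_comp \<M>) H)"

end

theory Submission
  imports Defs
begin

text \<open>
  Soundness of the equations rests on a substitution lemma: if \<open>h : \<lbrakk>\<Delta>\<rbrakk> \<rightarrow> \<lbrakk>\<Gamma>\<rbrakk>\<close> interprets a
  substitution \<open>s\<close>, then the denotation of a term under \<open>s\<close> is its denotation precomposed with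
  \<open>h\<close>. Let and handling both use \<open>smap f m = T f \<circ> st \<circ> \<langle>id, m\<rangle>\<close>, the action of \<open>T\<close> on morphisms in
  context, and the three handler equations follow from the three axioms on \<open>handle\<close>
  together with the laws of \<open>smap\<close> for \<open>\<eta>\<close>, \<open>\<mu>\<close> and the strength. All morphisms being total elements of
  one type, typing side conditions reduce to equations between \<open>Dom\<close> and \<open>Cod\<close>; these serve as
  conditions of rewrite rules that bring composites of pairings and projections into normal form.
\<close>

section \<open>Cartesian categories\<close>

text \<open>Denotations look types up through \<open>ty_of_val\<close> and
  \<open>ty_of_comp\<close>, definite descriptions that say nothing about an ill-typed term. Hence
  the inductions for substitution and for soundness carry typing along with the equality of
  morphisms, and typing of the right-hand side of an equation is a result, not an assumption.
  Products raise a second obstacle. \<open>tuple\<close> and \<open>op_tuple\<close> take their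
  factors from the codomains of the components, so the universal property speaks of the intended
  object only once these codomains are known. Domains and codomains of all denotations are therefore
  settled before substitution is treated; after that, handlers are compared projection by
  projection.\<close>

lemma is_product_proj: "is_product \<C> I X P p \<Longrightarrow> i \<in> I \<Longrightarrow> p i \<in> hom \<C> P (X i)"
  unfolding is_product_def by blast

lemma is_product_ex1:
  assumes "is_product \<C> I X P p" "\<And>i. i \<in> I \<Longrightarrow> f i \<in> hom \<C> Z (X i)"
  shows "\<exists>!h. h \<in> hom \<C> Z P \<and> (\<forall>i\<in>I. p i \<cdot>\<^bsub>\<C>\<^esub> h = f i)"
  using assms unfolding is_product_def by blast

text \<open>No category axioms are at hand here, so it is a hypothesis that the legs of
  \<open>h\<close> lie in the right hom sets. They form the cone whose mediating morphism is
  unique.\<close>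

lemma is_product_eqI:
  assumes "is_product \<C> I X P p" "g \<in> hom \<C> Z P" "h \<in> hom \<C> Z P"
    and "\<And>i. i \<in> I \<Longrightarrow> p i \<cdot>\<^bsub>\<C>\<^esub> h \<in> hom \<C> Z (X i)"
    and "\<And>i. i \<in> I \<Longrightarrow> p i \<cdot>\<^bsub>\<C>\<^esub> g = p i \<cdot>\<^bsub>\<C>\<^esub> h"
  shows "g = h"
  using is_product_ex1[OF assms(1,4)] assms(2,3,5) by blast

lemma mediating:
  assumes "is_product \<C> I X P p" "\<And>i. i \<in> I \<Longrightarrow> f i \<in> hom \<C> Z (X i)"
  shows "mediating \<C> I P p Z f \<in> hom \<C> Z P"
    and "i \<in> I \<Longrightarrow> p i \<cdot>\<^bsub>\<C>\<^esub> mediating \<C> I P p Z f = f i"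
proof -
  from theI'[OF is_product_ex1[OF assms]]
  show "mediating \<C> I P p Z f \<in> hom \<C> Z P"
    and "i \<in> I \<Longrightarrow> p i \<cdot>\<^bsub>\<C>\<^esub> mediating \<C> I P p Z f = f i"
    unfolding mediating_def by blast+
qed

locale cartesian_category =
  fixes \<C> :: "('op, 'o, 'm, 'z) cart_scheme" (structure)
  assumes cartesian: "cartesian \<C>"
begin

lemma category: "category \<C>"
  using cartesian by (simp add: cartesian_def)

lemma is_product_Prd: "is_product \<C> {..<length Xs} (\<lambda>i. Xs ! i) (Prd \<C> Xs) (Prj \<C> Xs)"
  using cartesian by (simp add: cartesian_def)

lemma is_product_OpPrd:
  "is_product \<C> (fset (fmdom F)) (\<lambda>op. the (fmlookup F op)) (OpPrd \<C> F) (OpPrj \<C> F)"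
  using cartesian by (simp add: cartesian_def)

lemma hom_iff: "f \<in> hom \<C> X Y \<longleftrightarrow> Dom \<C> f = X \<and> Cod \<C> f = Y"
  by (simp add: hom_def)

lemma Id_Dom_Cod [simp]: "Dom \<C> (Id \<C> X) = X" "Cod \<C> (Id \<C> X) = X"
  using category by (auto simp: category_def hom_iff)

lemma Cmp_Dom_Cod [simp]:
  assumes "Cod \<C> f = Dom \<C> g"
  shows "Dom \<C> (g \<cdot> f) = Dom \<C> f" "Cod \<C> (g \<cdot> f) = Cod \<C> g"
  using category assms by (auto simp: category_def hom_iff)

lemma Cmp_Id [simp]:
  "X = Dom \<C> f \<Longrightarrow> f \<cdot> Id \<C> X = f"
  "X = Cod \<C> f \<Longrightarrow> Id \<C> X \<cdot> f = f"
  using category by (auto simp: category_def hom_iff)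

text \<open>Composites are normalised by nesting to the right, so the left-hand side of a law such
  as \<open>St_natural\<close> is no longer a subterm once something is composed on its right. Later
  proofs therefore precompose both sides of a law with the remaining morphism by
  \<open>arg_cong\<close> and simplify the result.\<close>

lemma Cmp_assoc [simp]:
  assumes "Cod \<C> f = Dom \<C> g" "Cod \<C> g = Dom \<C> h"
  shows "(h \<cdot> g) \<cdot> f = h \<cdot> (g \<cdot> f)"
  using category assms by (auto simp: category_def hom_iff)

lemma Prj_Dom_Cod [simp]:
  assumes "i < length Xs"
  shows "Dom \<C> (Prj \<C> Xs i) = Prd \<C> Xs" "Cod \<C> (Prj \<C> Xs i) = Xs ! i"
  using is_product_proj[OF is_product_Prd, of i Xs] assms by (simp_all add: hom_iff)

lemma Prd_eqI:
  assumes "Cod \<C> g = Prd \<C> Xs" "Cod \<C> h = Prd \<C> Xs" "Dom \<C> g = Dom \<C> h"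
    and "\<And>i. i < length Xs \<Longrightarrow> Prj \<C> Xs i \<cdot> g = Prj \<C> Xs i \<cdot> h"
  shows "g = h"
  by (rule is_product_eqI[OF is_product_Prd]) (use assms in \<open>auto simp: hom_iff\<close>)

lemma OpPrj_Dom_Cod [simp]:
  assumes "fmlookup F op = Some X"
  shows "Dom \<C> (OpPrj \<C> F op) = OpPrd \<C> F" "Cod \<C> (OpPrj \<C> F op) = X"
  using is_product_proj[OF is_product_OpPrd fmdomI[OF assms]] assms by (simp_all add: hom_iff)

lemma OpPrd_eqI:
  assumes "Cod \<C> g = OpPrd \<C> F" "Cod \<C> h = OpPrd \<C> F" "Dom \<C> g = Dom \<C> h"
    and "\<And>op X. fmlookup F op = Some X \<Longrightarrow> OpPrj \<C> F op \<cdot> g = OpPrj \<C> F op \<cdot> h"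
  shows "g = h"
proof (rule is_product_eqI[OF is_product_OpPrd])
  show "g \<in> hom \<C> (Dom \<C> h) (OpPrd \<C> F)" "h \<in> hom \<C> (Dom \<C> h) (OpPrd \<C> F)"
    using assms(1-3) by (simp_all add: hom_iff)
  fix op assume "op \<in> fset (fmdom F)"
  then obtain X where X: "fmlookup F op = Some X"
    by (auto simp: fmlookup_dom_iff)
  with assms(2) show "OpPrj \<C> F op \<cdot> h \<in> hom \<C> (Dom \<C> h) (the (fmlookup F op))"
    by (simp add: hom_iff)
  from X show "OpPrj \<C> F op \<cdot> g = OpPrj \<C> F op \<cdot> h"
    by (rule assms(4))
qed

lemma tuple:
  assumes "\<And>f. f \<in> set fs \<Longrightarrow> Dom \<C> f = Z"
  shows "Dom \<C> (tuple \<C> Z fs) = Z" "Cod \<C> (tuple \<C> Z fs) = Prd \<C> (map (Cod \<C>) fs)"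
    "i < length fs \<Longrightarrow> Prj \<C> (map (Cod \<C>) fs) i \<cdot> tuple \<C> Z fs = fs ! i"
proof -
  have f: "fs ! i \<in> hom \<C> Z (map (Cod \<C>) fs ! i)" if "i \<in> {..<length (map (Cod \<C>) fs)}" for i
    using that assms by (simp add: hom_iff)
  from mediating(1)[OF is_product_Prd f]
  show "Dom \<C> (tuple \<C> Z fs) = Z" "Cod \<C> (tuple \<C> Z fs) = Prd \<C> (map (Cod \<C>) fs)"
    by (simp_all add: tuple_def hom_iff Let_def)
  from mediating(2)[OF is_product_Prd f, of i]
  show "i < length fs \<Longrightarrow> Prj \<C> (map (Cod \<C>) fs) i \<cdot> tuple \<C> Z fs = fs ! i"
    by (simp add: tuple_def Let_def)
qed

lemma op_tuple:
  assumes "\<And>op f. fmlookup fs op = Some f \<Longrightarrow> Dom \<C> f = Z"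
  shows "Dom \<C> (op_tuple \<C> Z fs) = Z" "Cod \<C> (op_tuple \<C> Z fs) = OpPrd \<C> (fmmap (Cod \<C>) fs)"
    "fmlookup fs op = Some f \<Longrightarrow> OpPrj \<C> (fmmap (Cod \<C>) fs) op \<cdot> op_tuple \<C> Z fs = f"
proof -
  let ?F = "fmmap (Cod \<C>) fs"
  have f: "the (fmlookup fs op) \<in> hom \<C> Z (the (fmlookup ?F op))" if "op \<in> fset (fmdom ?F)" for op
    using that assms by (auto simp: hom_iff fmlookup_dom_iff)
  from mediating(1)[OF is_product_OpPrd f]
  show "Dom \<C> (op_tuple \<C> Z fs) = Z" "Cod \<C> (op_tuple \<C> Z fs) = OpPrd \<C> ?F"
    by (simp_all add: op_tuple_def hom_iff Let_def)
  from mediating(2)[OF is_product_OpPrd f, of op]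
  show "fmlookup fs op = Some f \<Longrightarrow> OpPrj \<C> ?F op \<cdot> op_tuple \<C> Z fs = f"
    by (simp add: op_tuple_def fmdomI Let_def)
qed

lemma pair_Dom_Cod [simp]:
  assumes "Dom \<C> f = Dom \<C> g"
  shows "Dom \<C> (pair \<C> f g) = Dom \<C> g" "Cod \<C> (pair \<C> f g) = bprod \<C> (Cod \<C> f) (Cod \<C> g)"
proof -
  have "h \<in> set [f, g] \<Longrightarrow> Dom \<C> h = Dom \<C> f" for h
    using assms by auto
  from tuple(1,2)[of "[f, g]", OF this] assms
  show "Dom \<C> (pair \<C> f g) = Dom \<C> g" "Cod \<C> (pair \<C> f g) = bprod \<C> (Cod \<C> f) (Cod \<C> g)"
    by (simp_all add: pair_def)
qed

lemma pr_pair [simp]: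
  assumes "Dom \<C> f = Dom \<C> g" "Cod \<C> f = X" "Cod \<C> g = Y"
  shows "pr1 \<C> X Y \<cdot> pair \<C> f g = f" "pr2 \<C> X Y \<cdot> pair \<C> f g = g"
proof -
  have "h \<in> set [f, g] \<Longrightarrow> Dom \<C> h = Dom \<C> f" for h
    using assms by auto
  from tuple(3)[of "[f, g]", OF this, of 0] tuple(3)[of "[f, g]", OF this, of "Suc 0"] assms
  show "pr1 \<C> X Y \<cdot> pair \<C> f g = f" "pr2 \<C> X Y \<cdot> pair \<C> f g = g"
    by (simp_all add: pair_def)
qed

lemma bprod_eqI:
  assumes "Cod \<C> g = bprod \<C> X Y" "Cod \<C> h = bprod \<C> X Y" "Dom \<C> g = Dom \<C> h"
    and "pr1 \<C> X Y \<cdot> g = pr1 \<C> X Y \<cdot> h" "pr2 \<C> X Y \<cdot> g = pr2 \<C> X Y \<cdot> h"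
  shows "g = h"
  by (rule Prd_eqI[of _ "[X, Y]"]) (use assms in \<open>auto simp: less_Suc_eq\<close>)

lemma pair_Cmp [simp]:
  assumes "Dom \<C> f = Dom \<C> g" "Cod \<C> h = Dom \<C> g"
  shows "pair \<C> f g \<cdot> h = pair \<C> (f \<cdot> h) (g \<cdot> h)"
proof (rule bprod_eqI[of _ "Cod \<C> f" "Cod \<C> g"])
  show "pr1 \<C> (Cod \<C> f) (Cod \<C> g) \<cdot> (pair \<C> f g \<cdot> h) = pr1 \<C> (Cod \<C> f) (Cod \<C> g) \<cdot> pair \<C> (f \<cdot> h) (g \<cdot> h)"
    \<comment> \<open>One step against the normal form: only after nesting to the left does the
      projection meet the pairing.\<close>
    using assms by (subst Cmp_assoc[symmetric]) (simp_all del: Cmp_assoc)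
  show "pr2 \<C> (Cod \<C> f) (Cod \<C> g) \<cdot> (pair \<C> f g \<cdot> h) = pr2 \<C> (Cod \<C> f) (Cod \<C> g) \<cdot> pair \<C> (f \<cdot> h) (g \<cdot> h)"
    using assms by (subst Cmp_assoc[symmetric]) (simp_all del: Cmp_assoc)
qed (use assms in simp_all)

lemma pair_pr [simp]: "pair \<C> (pr1 \<C> X Y) (pr2 \<C> X Y) = Id \<C> (bprod \<C> X Y)"
  by (rule bprod_eqI[of _ X Y]) simp_all

text \<open>In normal form a projection usually has another morphism on its right, where
  \<open>pair_pr\<close> does not match.\<close>

lemma pair_pr_Cmp [simp]:
  assumes "Cod \<C> f = bprod \<C> X Y"
  shows "pair \<C> (pr1 \<C> X Y \<cdot> f) (pr2 \<C> X Y \<cdot> f) = f"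
  by (rule bprod_eqI[of _ X Y]) (use assms in simp_all)

end

section \<open>Strong monads and their action on morphisms in context\<close>

locale strong_monad_on = cartesian_category \<C> for \<C> :: "('op, 'o, 'm, 'z) cart_scheme" (structure) +
  fixes T :: "('o, 'm) monad"
  assumes strong_monad: "strong_monad \<C> T"
begin

lemma Map_Dom_Cod [simp]:
  "Dom \<C> (Map T f) = Ob T (Dom \<C> f)" "Cod \<C> (Map T f) = Ob T (Cod \<C> f)"
  using strong_monad by (auto simp: strong_monad_def monad_def hom_iff)

lemma Eta_Dom_Cod [simp]: "Dom \<C> (Eta T X) = X" "Cod \<C> (Eta T X) = Ob T X"
  using strong_monad by (auto simp: strong_monad_def monad_def hom_iff)

lemma Mu_Dom_Cod [simp]: "Dom \<C> (Mu T X) = Ob T (Ob T X)" "Cod \<C> (Mu T X) = Ob T X"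
  using strong_monad by (auto simp: strong_monad_def monad_def hom_iff)

lemma St_Dom_Cod [simp]:
  "Dom \<C> (St T X Y) = bprod \<C> X (Ob T Y)" "Cod \<C> (St T X Y) = Ob T (bprod \<C> X Y)"
  using strong_monad by (auto simp: strong_monad_def hom_iff)

lemma Map_Id [simp]: "Map T (Id \<C> X) = Id \<C> (Ob T X)"
  using strong_monad by (auto simp: strong_monad_def monad_def)

lemma Map_Cmp: "Cod \<C> f = Dom \<C> g \<Longrightarrow> Map T (g \<cdot> f) = Map T g \<cdot> Map T f"
  using strong_monad by (auto simp: strong_monad_def monad_def hom_iff)

lemma Map_Eta: "Dom \<C> f = X \<Longrightarrow> Map T f \<cdot> Eta T X = Eta T (Cod \<C> f) \<cdot> f"
  using strong_monad by (auto simp: strong_monad_def monad_def hom_iff)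

lemma Map_Mu: "Dom \<C> f = X \<Longrightarrow> Map T f \<cdot> Mu T X = Mu T (Cod \<C> f) \<cdot> Map T (Map T f)"
  using strong_monad by (auto simp: strong_monad_def monad_def hom_iff)

lemma Mu_laws:
  "Mu T X \<cdot> Eta T (Ob T X) = Id \<C> (Ob T X)"
  "Mu T X \<cdot> Map T (Eta T X) = Id \<C> (Ob T X)"
  "Mu T X \<cdot> Mu T (Ob T X) = Mu T X \<cdot> Map T (Mu T X)"
  using strong_monad by (auto simp: strong_monad_def monad_def)

lemma St_natural:
  "Dom \<C> f = X \<Longrightarrow> Dom \<C> g = Y \<Longrightarrow>
   Map T (prod_map \<C> f g) \<cdot> St T X Y = St T (Cod \<C> f) (Cod \<C> g) \<cdot> prod_map \<C> f (Map T g)"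
  using strong_monad by (auto simp: strong_monad_def hom_iff)

lemma St_pr2: "Map T (pr2 \<C> (terminal \<C>) X) \<cdot> St T (terminal \<C>) X = pr2 \<C> (terminal \<C>) (Ob T X)"
  using strong_monad by (auto simp: strong_monad_def)

lemma St_assoc: "Map T (assoc \<C> X Y Z) \<cdot> St T (bprod \<C> X Y) Z =
    St T X (bprod \<C> Y Z) \<cdot> prod_map \<C> (Id \<C> X) (St T Y Z) \<cdot> assoc \<C> X Y (Ob T Z)"
  using strong_monad unfolding strong_monad_def by blast

lemma St_Eta: "St T X Y \<cdot> prod_map \<C> (Id \<C> X) (Eta T Y) = Eta T (bprod \<C> X Y)"
  using strong_monad by (auto simp: strong_monad_def)

lemma St_Mu: "St T X Y \<cdot> prod_map \<C> (Id \<C> X) (Mu T Y) =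
    Mu T (bprod \<C> X Y) \<cdot> Map T (St T X Y) \<cdot> St T X (Ob T Y)"
  using strong_monad by (auto simp: strong_monad_def)

text \<open>Naturality of the strength in the form that survives normalisation, where the strength
  is applied to a pairing.\<close>

lemma St_pair:
  assumes "Dom \<C> f = Dom \<C> g" "Dom \<C> u = Cod \<C> f" "Cod \<C> g = Ob T (Dom \<C> v)"
  shows "St T (Cod \<C> u) (Cod \<C> v) \<cdot> pair \<C> (u \<cdot> f) (Map T v \<cdot> g)
    = Map T (prod_map \<C> u v) \<cdot> St T (Cod \<C> f) (Dom \<C> v) \<cdot> pair \<C> f g"
  using arg_cong[OF St_natural[of u "Cod \<C> f" v "Dom \<C> v"], of "\<lambda>k. k \<cdot> pair \<C> f g"] assms
  by (simp add: prod_map_def)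

text \<open>Functorial action of \<open>T\<close> in a context: \<open>m : G \<rightarrow> T A\<close> and \<open>f : G \<times> A \<rightarrow> B\<close> give \<open>G \<rightarrow> T B\<close>.\<close>

definition smap :: "'o \<Rightarrow> 'm \<Rightarrow> 'm \<Rightarrow> 'm" where
  "smap A f m = Map T f \<cdot> St T (Dom \<C> m) A \<cdot> pair \<C> (Id \<C> (Dom \<C> m)) m"

lemma smap_Dom_Cod [simp]:
  assumes "Cod \<C> m = Ob T A" "Dom \<C> f = bprod \<C> (Dom \<C> m) A"
  shows "Dom \<C> (smap A f m) = Dom \<C> m" "Cod \<C> (smap A f m) = Ob T (Cod \<C> f)"
  using assms by (simp_all add: smap_def)

lemma Map_smap:
  assumes "Cod \<C> m = Ob T A" "Dom \<C> f = bprod \<C> (Dom \<C> m) A" "Dom \<C> k = Cod \<C> f"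
  shows "Map T k \<cdot> smap A f m = smap A (k \<cdot> f) m"
  using assms by (simp add: smap_def Map_Cmp)

text \<open>Reading \<open>h\<close> as \<open>h\<close> after an identity and \<open>m\<close> as
  \<open>Map T (Id \<C> A)\<close> after \<open>m\<close>, naturality moves \<open>h\<close> past
  the strength and into \<open>f\<close>. Composites of this shape thus reduce to
  \<open>smap\<close> over the domain of \<open>m\<close>.\<close>

lemma Map_St_pair:
  assumes "Dom \<C> h = Dom \<C> m" "Cod \<C> m = Ob T A" "Dom \<C> f = bprod \<C> (Cod \<C> h) A"
  shows "Map T f \<cdot> (St T (Cod \<C> h) A \<cdot> pair \<C> h m)
    = smap A (f \<cdot> pair \<C> (h \<cdot> pr1 \<C> (Dom \<C> h) A) (pr2 \<C> (Dom \<C> h) A)) m"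
  using assms St_pair[of "Id \<C> (Dom \<C> h)" m h "Id \<C> A"]
  by (simp add: smap_def prod_map_def Map_Cmp)

text \<open>The change of context reaches \<open>f\<close> below its bound variable, which is left
  alone. This is the semantic counterpart of substituting under the binder of a let or of a return
  clause.\<close>

lemma smap_Cmp:
  assumes "Cod \<C> m = Ob T A" "Dom \<C> f = bprod \<C> (Dom \<C> m) A" "Cod \<C> h = Dom \<C> m"
  shows "smap A f m \<cdot> h = smap A (f \<cdot> pair \<C> (h \<cdot> pr1 \<C> (Dom \<C> h) A) (pr2 \<C> (Dom \<C> h) A)) (m \<cdot> h)"
  using assms Map_St_pair[of h "m \<cdot> h" A f] by (simp add: smap_def)

lemma smap_Eta:
  assumes "Cod \<C> v = A" "Dom \<C> f = bprod \<C> (Dom \<C> v) A"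
  shows "smap A f (Eta T A \<cdot> v) = Eta T (Cod \<C> f) \<cdot> (f \<cdot> pair \<C> (Id \<C> (Dom \<C> v)) v)"
proof -
  have "St T (Dom \<C> v) A \<cdot> pair \<C> (Id \<C> (Dom \<C> v)) (Eta T A \<cdot> v)
      = Eta T (bprod \<C> (Dom \<C> v) A) \<cdot> pair \<C> (Id \<C> (Dom \<C> v)) v"
    using arg_cong[OF St_Eta[of "Dom \<C> v" A], of "\<lambda>k. k \<cdot> pair \<C> (Id \<C> (Dom \<C> v)) v"] assms
    by (simp add: prod_map_def)
  then show ?thesis
    using assms arg_cong[OF Map_Eta[of f "bprod \<C> (Dom \<C> v) A"], of "\<lambda>k. k \<cdot> pair \<C> (Id \<C> (Dom \<C> v)) v"]
    by (simp add: smap_def)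
qed

text \<open>The unit law of the strength concerns the terminal object only. Since the second
  projection ignores the context, the context can be exchanged for the terminal object along the
  empty tuple \<open>b\<close>, and \<open>Map_St_pair\<close> translates back.\<close>

lemma smap_pr2:
  assumes "Cod \<C> m = Ob T A"
  shows "smap A (pr2 \<C> (Dom \<C> m) A) m = m"
proof -
  define b where "b = tuple \<C> (Dom \<C> m) []"
  have b: "Dom \<C> b = Dom \<C> m" "Cod \<C> b = terminal \<C>"
    using tuple(1,2)[of "[]" "Dom \<C> m"] by (simp_all add: b_def)
  have "m = Map T (pr2 \<C> (terminal \<C>) A) \<cdot> St T (terminal \<C>) A \<cdot> pair \<C> b m"
    by (subst St_pr2) (use assms b in simp)
  also have "\<dots> = smap A (pr2 \<C> (Dom \<C> m) A) m"
    using Map_St_pair[of b m A "pr2 \<C> (terminal \<C>) A"] assms b by simp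
  finally show ?thesis by simp
qed

text \<open>Two nested strengths use the same context twice. The associativity law merges them into
  one strength over the product of the context with itself, and the diagonal \<open>?d\<close> is
  then absorbed by \<open>Map_St_pair\<close>.\<close>

lemma St_smap:
  assumes "Cod \<C> m = Ob T A" "Dom \<C> f = bprod \<C> (Dom \<C> m) A" "Dom \<C> h = Dom \<C> m"
  shows "St T (Cod \<C> h) (Cod \<C> f) \<cdot> pair \<C> h (smap A f m)
    = smap A (pair \<C> (h \<cdot> pr1 \<C> (Dom \<C> m) A) f) m"
proof -
  let ?G = "Dom \<C> m"
  let ?d = "pair \<C> (Id \<C> ?G) (Id \<C> ?G)"
  have 1: "St T ?G (bprod \<C> ?G A) \<cdot> pair \<C> (Id \<C> ?G) (St T ?G A \<cdot> pair \<C> (Id \<C> ?G) m)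
    = Map T (assoc \<C> ?G ?G A) \<cdot> (St T (bprod \<C> ?G ?G) A \<cdot> pair \<C> ?d m)"
    using arg_cong[OF St_assoc[of ?G ?G A], of "\<lambda>k. k \<cdot> pair \<C> ?d m"] assms
    by (simp add: prod_map_def assoc_def Let_def)
  have "St T (Cod \<C> h) (Cod \<C> f) \<cdot> pair \<C> h (smap A f m)
    = Map T (prod_map \<C> h f) \<cdot> (St T ?G (bprod \<C> ?G A) \<cdot> pair \<C> (Id \<C> ?G) (St T ?G A \<cdot> pair \<C> (Id \<C> ?G) m))"
    using St_pair[of "Id \<C> ?G" "St T ?G A \<cdot> pair \<C> (Id \<C> ?G) m" h f] assms
    by (simp add: smap_def prod_map_def)
  also have "\<dots> = Map T (prod_map \<C> h f \<cdot> assoc \<C> ?G ?G A) \<cdot> (St T (bprod \<C> ?G ?G) A \<cdot> pair \<C> ?d m)"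
    unfolding 1 using assms by (subst Map_Cmp) (simp_all add: prod_map_def assoc_def Let_def)
  also have "\<dots> = smap A (pair \<C> (h \<cdot> pr1 \<C> ?G A) f) m"
    using assms Map_St_pair[of ?d m A "prod_map \<C> h f \<cdot> assoc \<C> ?G ?G A"]
    by (simp add: prod_map_def assoc_def Let_def)
  finally show ?thesis .
qed

text \<open>Common core of the associativity of let and of Handle-Let. The law of the strength for
  the multiplication and naturality of the multiplication bring it to the front. The pairing behind
  \<open>f\<close> forgets the variable of type \<open>A\<close>; it interprets the weakening
  \<open>ren_comp (up_ren Suc)\<close>.\<close>

lemma smap_Mu:
  assumes "Cod \<C> m = Ob T A" "Dom \<C> g = bprod \<C> (Dom \<C> m) A" "Cod \<C> g = Ob T B"
    "Dom \<C> f = bprod \<C> (Dom \<C> m) B"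
  shows "smap B f (Mu T B \<cdot> smap A g m) = Mu T (Cod \<C> f) \<cdot>
    smap A (smap B (f \<cdot> pair \<C> (pr1 \<C> (Dom \<C> m) A \<cdot> pr1 \<C> (bprod \<C> (Dom \<C> m) A) B)
                             (pr2 \<C> (bprod \<C> (Dom \<C> m) A) B)) g) m"
proof -
  let ?G = "Dom \<C> m"
  have 1: "St T ?G B \<cdot> pair \<C> (Id \<C> ?G) (Mu T B \<cdot> smap A g m)
     = Mu T (bprod \<C> ?G B) \<cdot> (Map T (St T ?G B) \<cdot> (St T ?G (Ob T B) \<cdot> pair \<C> (Id \<C> ?G) (smap A g m)))"
    using arg_cong[OF St_Mu[of ?G B], of "\<lambda>k. k \<cdot> pair \<C> (Id \<C> ?G) (smap A g m)"] assms
    by (simp add: prod_map_def)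
  have 2: "St T ?G (Ob T B) \<cdot> pair \<C> (Id \<C> ?G) (smap A g m) = smap A (pair \<C> (pr1 \<C> ?G A) g) m"
    using St_smap[of m A g "Id \<C> ?G"] assms by simp
  have "smap B f (Mu T B \<cdot> smap A g m) = Map T f \<cdot>
      (Mu T (bprod \<C> ?G B) \<cdot> (Map T (St T ?G B) \<cdot> smap A (pair \<C> (pr1 \<C> ?G A) g) m))"
    using 1 2 assms by (simp add: smap_def[of B])
  also have "\<dots> = Mu T (Cod \<C> f) \<cdot> (Map T (Map T f) \<cdot> (Map T (St T ?G B) \<cdot> smap A (pair \<C> (pr1 \<C> ?G A) g) m))"
    using assms arg_cong[OF Map_Mu[of f "bprod \<C> ?G B"], of "\<lambda>k. k \<cdot> (Map T (St T ?G B) \<cdot> smap A (pair \<C> (pr1 \<C> ?G A) g) m)"]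
    by simp
  also have "\<dots> = Mu T (Cod \<C> f) \<cdot> smap A (Map T f \<cdot> (St T ?G B \<cdot> pair \<C> (pr1 \<C> ?G A) g)) m"
    using assms by (simp add: Map_smap)
  finally show ?thesis
    using Map_St_pair[of "pr1 \<C> ?G A" g B f] assms by simp
qed

end

section \<open>Interpretation of typed terms\<close>

lemma up_sub_Var: "up_sub (Var \<circ> r) = Var \<circ> up_ren r"
  by (auto simp: up_sub_def up_ren_def fun_eq_iff split: nat.split)

text \<open>Variables substituted for variables pass binders as a renaming does, by
  \<open>up_sub_Var\<close>. A single induction on typing can therefore serve both renaming and
  substitution.\<close>

lemma ren_eq_sub:
  fixes V :: "'op val" and M :: "'op comp"
  shows "ren_val r V = sub_val (Var \<circ> r) V"
    and "ren_comp r M = sub_comp (Var \<circ> r) M"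
  by (induction V and M arbitrary: r and r rule: val.induct comp.induct)
    (auto simp: up_sub_Var intro!: fmap.map_cong0)

lemma ren_hdl_eq_sub: "ren_hdl r H = fmmap (sub_comp (up_sub (up_sub (Var \<circ> r)))) H"
  by (auto simp: ren_hdl_def ren_eq_sub up_sub_Var intro!: fmap.map_cong0)

lemma ty_of_val_eq: "val_ty \<Gamma> V A \<Longrightarrow> ty_of_val \<Gamma> V = A"
  unfolding ty_of_val_def by (rule the_equality) (auto dest: unique_typing)

lemma ty_of_comp_eq: "comp_ty \<Gamma> M C \<Longrightarrow> ty_of_comp \<Gamma> M = C"
  unfolding ty_of_comp_def by (rule the_equality) (auto dest: unique_typing)

text \<open>Unfolding \<open>sem_cty\<close> exposes the raw map; folding it back keeps denotations
  of signatures opaque. Proofs that look an entry up remove the rule.\<close>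

lemma sem_sig_simp [simp]: "fmmap (map_prod (sem_ty \<M>) (sem_ty \<M>)) \<Sigma> = sem_sig \<M> \<Sigma>"
  by (simp add: sem_sig_def)

lemma fmlookup_sem_sig:
  "fmlookup \<Sigma> op = Some (A, B) \<Longrightarrow> fmlookup (sem_sig \<M> \<Sigma>) op = Some (sem_ty \<M> A, sem_ty \<M> B)"
  by (simp add: sem_sig_def del: sem_sig_simp)

section \<open>Kleisli exponentials and handling in a model\<close>

locale eff_model =
  fixes \<M> :: "('op, 'o, 'm) model" (structure)
  assumes model: "lambda_eff_model \<M>"

sublocale eff_model \<subseteq> cartesian_category \<M>
  using model by unfold_locales (simp add: lambda_eff_model_def)

sublocale eff_model \<subseteq> mon: strong_monad_on \<M> "Mon \<M> S" for S
  using model by unfold_locales (simp add: lambda_eff_model_def)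

context eff_model
begin

lemma kleisli_exponentials: "kleisli_exponentials \<M> (Mon \<M> S) (KExp \<M> S)"
  using model by (simp add: lambda_eff_model_def)

lemma cur_bij: "bij_betw (cur \<M> S X Y Z) (kl_hom \<M> (Mon \<M> S) (bprod \<M> X Y) Z) (hom \<M> X (texp \<M> S Y Z))"
  using kleisli_exponentials unfolding kleisli_exponentials_def by blast

lemma cur_Dom_Cod [simp]:
  assumes "Dom \<M> f = bprod \<M> X Y" "Cod \<M> f = TOb \<M> S Z"
  shows "Dom \<M> (cur \<M> S X Y Z f) = X" "Cod \<M> (cur \<M> S X Y Z f) = texp \<M> S Y Z"
  using bij_betwE[OF cur_bij[of S X Y Z], rule_format, of f] assms by (simp_all add: kl_hom_def hom_iff)

lemma cur_Cmp:
  assumes "Dom \<M> f = bprod \<M> X Y" "Cod \<M> f = TOb \<M> S Z" "Cod \<M> g = X"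
  shows "cur \<M> S X Y Z f \<cdot> g =
    cur \<M> S (Dom \<M> g) Y Z (f \<cdot> pair \<M> (g \<cdot> pr1 \<M> (Dom \<M> g) Y) (pr2 \<M> (Dom \<M> g) Y))"
proof -
  have "cur \<M> S (Dom \<M> g) Y Z (f \<cdot> prod_map \<M> g (Id \<M> Y)) = cur \<M> S X Y Z f \<cdot> g"
    using kleisli_exponentials[of S] assms unfolding kleisli_exponentials_def kl_hom_def hom_iff by blast
  then show ?thesis by (simp add: prod_map_def)
qed

lemma ev_props:
  "ev \<M> S Y Z \<in> kl_hom \<M> (Mon \<M> S) (bprod \<M> (texp \<M> S Y Z) Y) Z"
  "cur \<M> S (texp \<M> S Y Z) Y Z (ev \<M> S Y Z) = Id \<M> (texp \<M> S Y Z)"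
proof -
  let ?E = "texp \<M> S Y Z"
  note b = cur_bij[of S ?E Y Z]
  \<comment> \<open>\<open>Ev\<close> is defined by \<open>the_inv_into\<close>, so it has its
    intended meaning only because the identity lies in the image of currying.\<close>
  have "Id \<M> ?E \<in> cur \<M> S ?E Y Z ` kl_hom \<M> (Mon \<M> S) (bprod \<M> ?E Y) Z"
    using bij_betw_imp_surj_on[OF b] by (simp add: hom_iff)
  then show "ev \<M> S Y Z \<in> kl_hom \<M> (Mon \<M> S) (bprod \<M> (texp \<M> S Y Z) Y) Z"
    "cur \<M> S (texp \<M> S Y Z) Y Z (ev \<M> S Y Z) = Id \<M> (texp \<M> S Y Z)"
    unfolding Ev_def
    by (auto intro!: the_inv_into_into f_the_inv_into_f bij_betw_imp_inj_on[OF b])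
qed

lemma ev_Dom_Cod [simp]:
  "Dom \<M> (ev \<M> S Y Z) = bprod \<M> (texp \<M> S Y Z) Y" "Cod \<M> (ev \<M> S Y Z) = TOb \<M> S Z"
  using ev_props(1)[of S Y Z] by (simp_all add: kl_hom_def hom_iff)

text \<open>The model provides only a natural bijection. By naturality, and since \<open>ev\<close>
  curries to the identity, both sides of the unapplied law \<open>?e = f\<close> have the same
  currying; injectivity gives the law, and precomposition with a pairing gives its applied
  form.\<close>

lemma ev_cur:
  assumes "Dom \<M> f = bprod \<M> X Y" "Cod \<M> f = TOb \<M> S Z" "Dom \<M> h = X" "Cod \<M> h = Y"
  shows "ev \<M> S Y Z \<cdot> pair \<M> (cur \<M> S X Y Z f) h = f \<cdot> pair \<M> (Id \<M> X) h"
proof -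
  let ?c = "cur \<M> S X Y Z"
  let ?e = "ev \<M> S Y Z \<cdot> pair \<M> (?c f \<cdot> pr1 \<M> X Y) (pr2 \<M> X Y)"
  have "?c ?e = ?c f"
    using cur_Cmp[of "ev \<M> S Y Z" "texp \<M> S Y Z" Y S Z "?c f"] assms ev_props(2)[of S Y Z] by simp
  then have "?e = f"
    by (rule inj_onD[OF bij_betw_imp_inj_on[OF cur_bij]]) (use assms in \<open>simp_all add: kl_hom_def hom_iff\<close>)
  from arg_cong[OF this, of "\<lambda>k. k \<cdot> pair \<M> (Id \<M> X) h"] assms show ?thesis by simp
qed

text \<open>The \<eta> law is naturality of currying at \<open>ev\<close>, whose currying is the
  identity.\<close>

lemma cur_ev_pair:
  assumes "Cod \<M> g = texp \<M> S Y Z" "Dom \<M> g = X"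
  shows "cur \<M> S X Y Z (ev \<M> S Y Z \<cdot> pair \<M> (g \<cdot> pr1 \<M> X Y) (pr2 \<M> X Y)) = g"
  using cur_Cmp[of "ev \<M> S Y Z" "texp \<M> S Y Z" Y S Z g] ev_props(2)[of S Y Z] assms by simp

lemma OpMor_Dom_Cod:
  "fmlookup S op = Some (A, B) \<Longrightarrow> Dom \<M> (OpMor \<M> S op) = A \<and> Cod \<M> (OpMor \<M> S op) = TOb \<M> S B"
  using model by (auto simp: lambda_eff_model_def hom_iff)

lemma Hnd_Dom_Cod [simp]:
  "Dom \<M> (Hnd \<M> S S' X) = bprod \<M> (hobj \<M> S S' X) (TOb \<M> S (TOb \<M> S' X))"
  "Cod \<M> (Hnd \<M> S S' X) = TOb \<M> S' X"
  using model unfolding lambda_eff_model_def hom_iff by blast+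

lemma hprj_Dom_Cod:
  assumes "fmlookup S op = Some (A, B)"
  shows "Dom \<M> (hprj \<M> S S' X op) = hobj \<M> S S' X"
    "Cod \<M> (hprj \<M> S S' X op) = texp \<M> S' (bprod \<M> A (texp \<M> S' B X)) X"
proof -
  have "fmlookup (hfam \<M> S S' X) op = Some (texp \<M> S' (bprod \<M> A (texp \<M> S' B X)) X)"
    using assms by (simp add: hfam_def)
  then show "Dom \<M> (hprj \<M> S S' X op) = hobj \<M> S S' X"
    "Cod \<M> (hprj \<M> S S' X op) = texp \<M> S' (bprod \<M> A (texp \<M> S' B X)) X"
    by (simp_all add: hprj_def hobj_def)
qed

lemma hobj_eqI:
  assumes "Cod \<M> g = hobj \<M> S S' X" "Cod \<M> h = hobj \<M> S S' X" "Dom \<M> g = Dom \<M> h"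
    and "\<And>op A B. fmlookup S op = Some (A, B) \<Longrightarrow> hprj \<M> S S' X op \<cdot> g = hprj \<M> S S' X op \<cdot> h"
  shows "g = h"
  by (rule OpPrd_eqI[of _ "hfam \<M> S S' X"])
    (use assms in \<open>auto simp: hobj_def hprj_def hfam_def\<close>)

lemma Hnd_Eta:
  assumes "Cod \<M> h = hobj \<M> S S' X" "Cod \<M> m = TOb \<M> S' X" "Dom \<M> h = Dom \<M> m"
  shows "Hnd \<M> S S' X \<cdot> pair \<M> h (eta \<M> S (TOb \<M> S' X) \<cdot> m) = m"
proof -
  have "Hnd \<M> S S' X \<cdot> prod_map \<M> (Id \<M> (hobj \<M> S S' X)) (eta \<M> S (TOb \<M> S' X)) =
        pr2 \<M> (hobj \<M> S S' X) (TOb \<M> S' X)"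
    using model unfolding lambda_eff_model_def by blast
  from arg_cong[OF this, of "\<lambda>k. k \<cdot> pair \<M> h m"] assms show ?thesis
    by (simp add: prod_map_def)
qed

lemma Hnd_Mu:
  assumes "Cod \<M> h = hobj \<M> S S' X" "Cod \<M> m = TOb \<M> S (TOb \<M> S (TOb \<M> S' X))" "Dom \<M> h = Dom \<M> m"
  shows "Hnd \<M> S S' X \<cdot> pair \<M> h (mu \<M> S (TOb \<M> S' X) \<cdot> m) = Hnd \<M> S S' X \<cdot>
    pair \<M> h (TMap \<M> S (Hnd \<M> S S' X) \<cdot> (st \<M> S (hobj \<M> S S' X) (TOb \<M> S (TOb \<M> S' X)) \<cdot> pair \<M> h m))"
proof -
  let ?H = "hobj \<M> S S' X" and ?Y = "TOb \<M> S (TOb \<M> S' X)"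
  have "Hnd \<M> S S' X \<cdot> prod_map \<M> (Id \<M> ?H) (mu \<M> S (TOb \<M> S' X)) =
        Hnd \<M> S S' X \<cdot> prod_map \<M> (Id \<M> ?H) (TMap \<M> S (Hnd \<M> S S' X))
          \<cdot> pair \<M> (pr1 \<M> ?H (TOb \<M> S ?Y)) (st \<M> S ?H ?Y)"
    using model unfolding lambda_eff_model_def Let_def by blast
  from arg_cong[OF this, of "\<lambda>k. k \<cdot> pair \<M> h m"] assms show ?thesis
    by (simp add: prod_map_def)
qed

text \<open>The axiom mentions \<open>aop\<close>, which takes an argument and a curried
  continuation. Feeding it \<open>v\<close> and the currying of \<open>f\<close> lets evaluation
  undo the currying under the monad, so the axiom becomes a statement about an operation followed by
  an arbitrary \<open>f\<close>.\<close>

lemma Hnd_op: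
  assumes op: "fmlookup S op = Some (A, B)"
    and dc: "Cod \<M> h = hobj \<M> S S' X" "Cod \<M> v = A" "Dom \<M> h = Dom \<M> v"
      "Dom \<M> f = bprod \<M> (Dom \<M> v) B" "Cod \<M> f = TOb \<M> S' X"
  shows "Hnd \<M> S S' X \<cdot> pair \<M> h (mon.smap S B f (OpMor \<M> S op \<cdot> v)) =
    ev \<M> S' (bprod \<M> A (texp \<M> S' B X)) X \<cdot>
      pair \<M> (hprj \<M> S S' X op \<cdot> h) (pair \<M> v (cur \<M> S' (Dom \<M> v) B X f))"
proof -
  note o = conjunct1[OF OpMor_Dom_Cod[OF op]] conjunct2[OF OpMor_Dom_Cod[OF op]]
  let ?c = "cur \<M> S' (Dom \<M> v) B X f"
  have "aop \<M> S S' X op B \<cdot> pair \<M> v ?c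
      = TMap \<M> S (ev \<M> S' B X) \<cdot> (st \<M> S (Cod \<M> ?c) B \<cdot> pair \<M> ?c (OpMor \<M> S op \<cdot> v))"
    using dc o by (simp add: aop_def Let_def prod_map_def swap_def)
  also have "\<dots> = mon.smap S B (ev \<M> S' B X \<cdot> pair \<M> (?c \<cdot> pr1 \<M> (Dom \<M> v) B) (pr2 \<M> (Dom \<M> v) B)) (OpMor \<M> S op \<cdot> v)"
    using dc o by (subst mon.Map_St_pair) simp_all
  also have "ev \<M> S' B X \<cdot> pair \<M> (?c \<cdot> pr1 \<M> (Dom \<M> v) B) (pr2 \<M> (Dom \<M> v) B) = f"
    \<comment> \<open>\<open>cur_Cmp\<close> turns the weakened currying into a currying over the
      extended context; evaluating it at the last variable contracts the duplicated variable
      again.\<close>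
    using ev_cur[of "f \<cdot> pair \<M> (pr1 \<M> (Dom \<M> v) B \<cdot> pr1 \<M> (bprod \<M> (Dom \<M> v) B) B) (pr2 \<M> (bprod \<M> (Dom \<M> v) B) B)"
        "bprod \<M> (Dom \<M> v) B" B S' X "pr2 \<M> (Dom \<M> v) B"] dc
    by (simp add: cur_Cmp)
  finally have a: "aop \<M> S S' X op B \<cdot> pair \<M> v ?c = mon.smap S B f (OpMor \<M> S op \<cdot> v)" .
  have "Hnd \<M> S S' X \<cdot> prod_map \<M> (Id \<M> (hobj \<M> S S' X)) (aop \<M> S S' X op B) =
        ev \<M> S' (bprod \<M> A (texp \<M> S' B X)) X
          \<cdot> prod_map \<M> (hprj \<M> S S' X op) (Id \<M> (bprod \<M> A (texp \<M> S' B X)))"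
    using model op unfolding lambda_eff_model_def by blast
  from arg_cong[OF this, of "\<lambda>k. k \<cdot> pair \<M> h (pair \<M> v ?c)"] show ?thesis
    using dc o hprj_Dom_Cod[OF op]
    by (simp add: prod_map_def a[symmetric]) (simp add: aop_def Let_def prod_map_def swap_def)
qed

section \<open>Domains, codomains and typed equations for denotations\<close>

lemma sem_var_Dom_Cod:
  "i < length \<Gamma> \<Longrightarrow> Dom \<M> (sem_var \<M> \<Gamma> i) = sem_ctx \<M> \<Gamma> \<and> Cod \<M> (sem_var \<M> \<Gamma> i) = sem_ty \<M> (\<Gamma> ! i)"
  by (induction \<Gamma> arbitrary: i) (auto split: nat.split)

text \<open>A property of the denotation alone. The lemmas on tuples and handlers assume it in place
  of typing, so that they are usable inside the induction that derives it from typing.\<close>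

definition val_in :: "'op ctx \<Rightarrow> 'op val \<Rightarrow> 'op ty \<Rightarrow> bool" where
  "val_in \<Gamma> V A \<longleftrightarrow> Dom \<M> (sem_val \<M> V \<Gamma>) = sem_ctx \<M> \<Gamma> \<and> Cod \<M> (sem_val \<M> V \<Gamma>) = sem_ty \<M> A"

definition comp_in :: "'op ctx \<Rightarrow> 'op comp \<Rightarrow> 'op cty \<Rightarrow> bool" where
  "comp_in \<Gamma> M C \<longleftrightarrow> Dom \<M> (sem_comp \<M> M \<Gamma>) = sem_ctx \<M> \<Gamma> \<and>
     Cod \<M> (sem_comp \<M> M \<Gamma>) = TOb \<M> (fst (sem_cty \<M> C)) (snd (sem_cty \<M> C))"

lemma sem_Tup:
  assumes "length Vs = length As" "\<And>i. i < length As \<Longrightarrow> val_in \<Gamma> (Vs ! i) (As ! i)"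
  shows "val_in \<Gamma> (Tup Vs) (Prod As)"
    and "i < length As \<Longrightarrow> Prj \<M> (map (sem_ty \<M>) As) i \<cdot> sem_val \<M> (Tup Vs) \<Gamma> = sem_val \<M> (Vs ! i) \<Gamma>"
proof -
  let ?fs = "map (\<lambda>V. sem_val \<M> V \<Gamma>) Vs"
  have 1: "f \<in> set ?fs \<Longrightarrow> Dom \<M> f = sem_ctx \<M> \<Gamma>" for f
    using assms by (auto simp: val_in_def in_set_conv_nth)
  \<comment> \<open>The factors read off by \<open>tuple\<close> are the intended ones, so its
    projections are those for \<open>As\<close>.\<close>
  have 2: "map (Cod \<M>) ?fs = map (sem_ty \<M>) As"
    using assms by (intro nth_equalityI) (auto simp: val_in_def)
  note t = tuple[of ?fs, OF 1, unfolded 2]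
  show "val_in \<Gamma> (Tup Vs) (Prod As)"
    using t(1,2) by (simp add: val_in_def)
  show "i < length As \<Longrightarrow> Prj \<M> (map (sem_ty \<M>) As) i \<cdot> sem_val \<M> (Tup Vs) \<Gamma> = sem_val \<M> (Vs ! i) \<Gamma>"
    using t(3)[of i] assms(1) by simp
qed

text \<open>Once the family of codomains of the clauses is identified with \<open>hfam\<close>, all
  three claims are the universal property of the product over operations.\<close>

lemma sem_hdl:
  fixes \<Gamma> :: "'op ctx"
  assumes "fmdom H = fmdom \<Sigma>"
    and clause: "\<And>op A B M. fmlookup \<Sigma> op = Some (A, B) \<Longrightarrow> fmlookup H op = Some M
       \<Longrightarrow> comp_in (Fun B (Comp X \<Sigma>') # A # \<Gamma>) M (Comp X \<Sigma>')"
  defines "S \<equiv> sem_sig \<M> \<Sigma>" and "S' \<equiv> sem_sig \<M> \<Sigma>'" and "x \<equiv> sem_ty \<M> X" and "G \<equiv> sem_ctx \<M> \<Gamma>"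
  shows "Dom \<M> (sem_hdl \<M> H \<Gamma> \<Sigma> (Comp X \<Sigma>')) = G"
    and "Cod \<M> (sem_hdl \<M> H \<Gamma> \<Sigma> (Comp X \<Sigma>')) = hobj \<M> S S' x"
    and "\<And>op A B M. fmlookup \<Sigma> op = Some (A, B) \<Longrightarrow> fmlookup H op = Some M \<Longrightarrow>
      hprj \<M> S S' x op \<cdot> sem_hdl \<M> H \<Gamma> \<Sigma> (Comp X \<Sigma>') =
      cur \<M> S' G (bprod \<M> (sem_ty \<M> A) (texp \<M> S' (sem_ty \<M> B) x)) x
        (sem_comp \<M> M (Fun B (Comp X \<Sigma>') # A # \<Gamma>) \<cdot>
          assoc_inv \<M> G (sem_ty \<M> A) (texp \<M> S' (sem_ty \<M> B) x))"
proof -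
  define c where "c = (\<lambda>op d. case the (fmlookup \<Sigma> op) of (A, B) \<Rightarrow>
       let a = sem_ty \<M> A; k = sem_ty \<M> (Fun B (Comp X \<Sigma>'))
       in cur \<M> S' G (bprod \<M> a k) x (d (Fun B (Comp X \<Sigma>') # A # \<Gamma>) \<cdot> assoc_inv \<M> G a k))"
  define fs where "fs = fmmap_keys c (fmmap (sem_comp \<M>) H)"
  have hdl: "sem_hdl \<M> H \<Gamma> \<Sigma> (Comp X \<Sigma>') = op_tuple \<M> G fs"
    by (simp add: sem_hdl_def hdl_tuple_def fs_def c_def S'_def x_def G_def Let_def)
  have lookup: "fmlookup fs op = Some (cur \<M> S' G (bprod \<M> (sem_ty \<M> A) (texp \<M> S' (sem_ty \<M> B) x)) x
        (sem_comp \<M> M (Fun B (Comp X \<Sigma>') # A # \<Gamma>) \<cdot>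
          assoc_inv \<M> G (sem_ty \<M> A) (texp \<M> S' (sem_ty \<M> B) x)))"
    and arr: "Dom \<M> (cur \<M> S' G (bprod \<M> (sem_ty \<M> A) (texp \<M> S' (sem_ty \<M> B) x)) x
        (sem_comp \<M> M (Fun B (Comp X \<Sigma>') # A # \<Gamma>) \<cdot>
          assoc_inv \<M> G (sem_ty \<M> A) (texp \<M> S' (sem_ty \<M> B) x))) = G"
      "Cod \<M> (cur \<M> S' G (bprod \<M> (sem_ty \<M> A) (texp \<M> S' (sem_ty \<M> B) x)) x
        (sem_comp \<M> M (Fun B (Comp X \<Sigma>') # A # \<Gamma>) \<cdot>
          assoc_inv \<M> G (sem_ty \<M> A) (texp \<M> S' (sem_ty \<M> B) x))) =
       texp \<M> S' (bprod \<M> (sem_ty \<M> A) (texp \<M> S' (sem_ty \<M> B) x)) x"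
    if "fmlookup \<Sigma> op = Some (A, B)" "fmlookup H op = Some M" for op A B M
    using that clause[OF that]
    by (simp_all add: fs_def c_def comp_in_def S'_def x_def G_def assoc_inv_def Let_def)
  have dom: "\<exists>A B M. fmlookup \<Sigma> op = Some (A, B) \<and> fmlookup H op = Some M" if "fmlookup fs op = Some f" for op f
  proof -
    from that obtain M where M: "fmlookup H op = Some M"
      by (auto simp: fs_def)
    then have "op |\<in>| fmdom \<Sigma>"
      using assms(1) by (metis fmdomI)
    with M show ?thesis by (auto simp: fmlookup_dom_iff)
  qed
  have D: "Dom \<M> f = G" if "fmlookup fs op = Some f" for op f
    using dom[OF that] that lookup arr(1) by (metis option.inject)
  \<comment> \<open>The tuple ranges over the operations of \<open>H\<close>, while
    \<open>handle\<close> expects those of \<Sigma>; the assumption on \<open>fmdom\<close> makes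
    the two finite maps agree.\<close>
  have F: "fmmap (Cod \<M>) fs = hfam \<M> S S' x"
  proof (rule fmap_ext)
    fix op
    show "fmlookup (fmmap (Cod \<M>) fs) op = fmlookup (hfam \<M> S S' x) op"
    proof (cases "fmlookup \<Sigma> op")
      case None
      then have "fmlookup H op = None"
        using assms(1) by (metis fmdom_notD fmdom_notI)
      with None show ?thesis
        by (simp add: fs_def hfam_def S_def sem_sig_def del: sem_sig_simp)
    next
      case (Some AB)
      obtain A B where AB: "AB = (A, B)" by (cases AB)
      from Some have "op |\<in>| fmdom H"
        using assms(1) by (metis fmdomI)
      then obtain M where "fmlookup H op = Some M"
        by (auto simp: fmlookup_dom_iff)
      with Some AB lookup[of op A B M] arr(2)[of op A B M] show ?thesis
        by (simp add: hfam_def S_def fmlookup_sem_sig)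
    qed
  qed
  have t: "Dom \<M> (op_tuple \<M> G fs) = G" "Cod \<M> (op_tuple \<M> G fs) = OpPrd \<M> (hfam \<M> S S' x)"
    unfolding F[symmetric] by (blast intro: op_tuple D)+
  have t': "OpPrj \<M> (hfam \<M> S S' x) op \<cdot> op_tuple \<M> G fs = f" if "fmlookup fs op = Some f" for op f
    unfolding F[symmetric] using that by (blast intro: op_tuple D)+
  show "Dom \<M> (sem_hdl \<M> H \<Gamma> \<Sigma> (Comp X \<Sigma>')) = G"
    "Cod \<M> (sem_hdl \<M> H \<Gamma> \<Sigma> (Comp X \<Sigma>')) = hobj \<M> S S' x"
    using t(1,2) by (simp_all add: hdl hobj_def)
  show "hprj \<M> S S' x op \<cdot> sem_hdl \<M> H \<Gamma> \<Sigma> (Comp X \<Sigma>') =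
      cur \<M> S' G (bprod \<M> (sem_ty \<M> A) (texp \<M> S' (sem_ty \<M> B) x)) x
        (sem_comp \<M> M (Fun B (Comp X \<Sigma>') # A # \<Gamma>) \<cdot>
          assoc_inv \<M> G (sem_ty \<M> A) (texp \<M> S' (sem_ty \<M> B) x))"
    if "fmlookup \<Sigma> op = Some (A, B)" "fmlookup H op = Some M" for op A B M
    using t'[OF lookup[OF that]] by (simp add: hdl hprj_def)
qed

text \<open>For typed terms the type lookups in the defining equations have known results. These
  versions replace the defining equations, which are then removed from the simp set except for
  variables.\<close>

lemma sem_Lam:
  "comp_ty (A # \<Gamma>) M (Comp B \<Sigma>) \<Longrightarrow> sem_val \<M> (Lam A M) \<Gamma> =
    cur \<M> (sem_sig \<M> \<Sigma>) (sem_ctx \<M> \<Gamma>) (sem_ty \<M> A) (sem_ty \<M> B) (sem_comp \<M> M (A # \<Gamma>))"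
  by (simp add: ty_of_comp_eq)

lemma sem_Proj:
  "val_ty \<Gamma> V (Prod As) \<Longrightarrow> sem_val \<M> (Proj i V) \<Gamma> = Prj \<M> (map (sem_ty \<M>) As) i \<cdot> sem_val \<M> V \<Gamma>"
  by (simp add: ty_of_val_eq)

lemma sem_App:
  "val_ty \<Gamma> V (Fun A (Comp B \<Sigma>)) \<Longrightarrow> sem_comp \<M> (App V W) \<Gamma> =
    ev \<M> (sem_sig \<M> \<Sigma>) (sem_ty \<M> A) (sem_ty \<M> B) \<cdot> pair \<M> (sem_val \<M> V \<Gamma>) (sem_val \<M> W \<Gamma>)"
  by (simp add: ty_of_val_eq)

lemma sem_Ret:
  "val_ty \<Gamma> V A \<Longrightarrow> sem_comp \<M> (Ret \<Sigma> V) \<Gamma> = eta \<M> (sem_sig \<M> \<Sigma>) (sem_ty \<M> A) \<cdot> sem_val \<M> V \<Gamma>"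
  by (simp add: ty_of_val_eq)

lemma sem_Let:
  assumes "comp_ty \<Gamma> M (Comp A \<Sigma>)" "comp_ty (A # \<Gamma>) N (Comp B \<Sigma>)"
    and "comp_in \<Gamma> M (Comp A \<Sigma>)" "comp_in (A # \<Gamma>) N (Comp B \<Sigma>)"
  shows "sem_comp \<M> (LetIn M N) \<Gamma> = mu \<M> (sem_sig \<M> \<Sigma>) (sem_ty \<M> B) \<cdot>
    mon.smap (sem_sig \<M> \<Sigma>) (sem_ty \<M> A) (sem_comp \<M> N (A # \<Gamma>)) (sem_comp \<M> M \<Gamma>)"
  using assms by (simp add: ty_of_comp_eq mon.smap_def comp_in_def Let_def)

lemma sem_Handle:
  assumes "comp_ty \<Gamma> M (Comp A \<Sigma>)" "comp_ty (A # \<Gamma>) N (Comp B \<Sigma>')" "comp_in \<Gamma> M (Comp A \<Sigma>)"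
    "comp_in (A # \<Gamma>) N (Comp B \<Sigma>')"
  shows "sem_comp \<M> (Handle M H N) \<Gamma> = Hnd \<M> (sem_sig \<M> \<Sigma>) (sem_sig \<M> \<Sigma>') (sem_ty \<M> B) \<cdot>
    pair \<M> (sem_hdl \<M> H \<Gamma> \<Sigma> (Comp B \<Sigma>'))
      (mon.smap (sem_sig \<M> \<Sigma>) (sem_ty \<M> A) (sem_comp \<M> N (A # \<Gamma>)) (sem_comp \<M> M \<Gamma>))"
  using assms by (simp add: ty_of_comp_eq mon.smap_def comp_in_def sem_hdl_def Let_def)

declare sem_val.simps(2-) [simp del] and sem_comp.simps [simp del]

text \<open>For handlers the induction only collects facts about the clauses; in the case of
  \<open>Handle\<close>, \<open>sem_hdl\<close> turns them into the domain and codomain of the whole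
  tuple.\<close>

lemma sem_typed:
  "val_ty \<Gamma> V A \<Longrightarrow> val_in \<Gamma> V A"
  "comp_ty \<Gamma> M C \<Longrightarrow> comp_in \<Gamma> M C"
  "hdl_ty \<Gamma> H \<Sigma> C \<Longrightarrow> fmdom H = fmdom \<Sigma> \<and> (\<forall>op A B M. fmlookup \<Sigma> op = Some (A, B) \<longrightarrow> fmlookup H op = Some M
       \<longrightarrow> comp_in (Fun B C # A # \<Gamma>) M C)"
proof (induction rule: val_ty_comp_ty_hdl_ty.inducts)
  case (ty_Var i \<Gamma>)
  then show ?case by (simp add: val_in_def sem_var_Dom_Cod)
next
  case (ty_Lam A \<Gamma> M C)
  then show ?case
    by (cases C) (simp add: val_in_def comp_in_def sem_Lam)
next
  case (ty_Tup Vs As \<Gamma>)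
  then show ?case by (intro sem_Tup(1)) auto
next
  case (ty_Proj \<Gamma> V As i)
  then show ?case
    by (simp add: val_in_def sem_Proj)
next
  case (ty_App \<Gamma> V A C W)
  then show ?case
    by (cases C) (simp add: val_in_def comp_in_def sem_App)
next
  case (ty_Ret \<Gamma> V A \<Sigma>)
  then show ?case
    by (simp add: val_in_def comp_in_def sem_Ret)
next
  case (ty_Let \<Gamma> M A \<Sigma> N B)
  from sem_Let[OF ty_Let] ty_Let(3,4) show ?case
    by (simp add: comp_in_def)
next
  case (ty_Op \<Sigma> op A B \<Gamma> V)
  from OpMor_Dom_Cod[OF fmlookup_sem_sig[OF ty_Op(1)], of \<M>] ty_Op(3) show ?case
    by (simp add: val_in_def comp_in_def sem_comp.simps(4))
next
  case (ty_Handle \<Gamma> M A \<Sigma> H C N)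
  obtain B \<Sigma>' where C: "C = Comp B \<Sigma>'" by (cases C)
  note h = sem_hdl[of H \<Sigma> B \<Sigma>' \<Gamma>]
  from ty_Handle C h(1,2) show ?case
    using sem_Handle[of \<Gamma> M A \<Sigma> N B \<Sigma>' H]
    by (simp add: comp_in_def)
next
  case (ty_Hdl H \<Sigma> C \<Gamma>)
  then show ?case by blast
qed

lemma sem_Let_typed:
  assumes "comp_ty \<Gamma> M (Comp A \<Sigma>)" "comp_ty (A # \<Gamma>) N (Comp B \<Sigma>)"
  shows "sem_comp \<M> (LetIn M N) \<Gamma> = mu \<M> (sem_sig \<M> \<Sigma>) (sem_ty \<M> B) \<cdot>
    mon.smap (sem_sig \<M> \<Sigma>) (sem_ty \<M> A) (sem_comp \<M> N (A # \<Gamma>)) (sem_comp \<M> M \<Gamma>)"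
  using assms by (intro sem_Let sem_typed)

lemma sem_Handle_typed:
  assumes "comp_ty \<Gamma> M (Comp A \<Sigma>)" "comp_ty (A # \<Gamma>) N (Comp B \<Sigma>')"
  shows "sem_comp \<M> (Handle M H N) \<Gamma> = Hnd \<M> (sem_sig \<M> \<Sigma>) (sem_sig \<M> \<Sigma>') (sem_ty \<M> B) \<cdot>
    pair \<M> (sem_hdl \<M> H \<Gamma> \<Sigma> (Comp B \<Sigma>'))
      (mon.smap (sem_sig \<M> \<Sigma>) (sem_ty \<M> A) (sem_comp \<M> N (A # \<Gamma>)) (sem_comp \<M> M \<Gamma>))"
  using assms by (intro sem_Handle sem_typed)

lemma sem_val_Dom_Cod:
  assumes "val_ty \<Gamma> V A"
  shows "Dom \<M> (sem_val \<M> V \<Gamma>) = sem_ctx \<M> \<Gamma>" "Cod \<M> (sem_val \<M> V \<Gamma>) = sem_ty \<M> A"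
  using sem_typed(1)[OF assms] by (simp_all add: val_in_def)

lemma sem_comp_Dom_Cod:
  assumes "comp_ty \<Gamma> M (Comp A \<Sigma>)"
  shows "Dom \<M> (sem_comp \<M> M \<Gamma>) = sem_ctx \<M> \<Gamma>"
    "Cod \<M> (sem_comp \<M> M \<Gamma>) = TOb \<M> (sem_sig \<M> \<Sigma>) (sem_ty \<M> A)"
  using sem_typed(2)[OF assms] by (simp_all add: comp_in_def)

lemma sem_hdl_typed:
  assumes "hdl_ty \<Gamma> H \<Sigma> (Comp X \<Sigma>')"
  shows "Dom \<M> (sem_hdl \<M> H \<Gamma> \<Sigma> (Comp X \<Sigma>')) = sem_ctx \<M> \<Gamma>"
    and "Cod \<M> (sem_hdl \<M> H \<Gamma> \<Sigma> (Comp X \<Sigma>')) = hobj \<M> (sem_sig \<M> \<Sigma>) (sem_sig \<M> \<Sigma>') (sem_ty \<M> X)"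
    and "\<And>op A B M. fmlookup \<Sigma> op = Some (A, B) \<Longrightarrow> fmlookup H op = Some M \<Longrightarrow>
      hprj \<M> (sem_sig \<M> \<Sigma>) (sem_sig \<M> \<Sigma>') (sem_ty \<M> X) op \<cdot> sem_hdl \<M> H \<Gamma> \<Sigma> (Comp X \<Sigma>') =
      cur \<M> (sem_sig \<M> \<Sigma>') (sem_ctx \<M> \<Gamma>) (bprod \<M> (sem_ty \<M> A) (sem_ty \<M> (Fun B (Comp X \<Sigma>')))) (sem_ty \<M> X)
        (sem_comp \<M> M (Fun B (Comp X \<Sigma>') # A # \<Gamma>) \<cdot>
          assoc_inv \<M> (sem_ctx \<M> \<Gamma>) (sem_ty \<M> A) (sem_ty \<M> (Fun B (Comp X \<Sigma>'))))"
  using sem_hdl[of H \<Sigma> X \<Sigma>' \<Gamma>] sem_typed(3)[OF assms] by simp_all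

section \<open>Substitution\<close>

text \<open>The morphism \<open>h : \<lbrakk>\<Delta>\<rbrakk> \<rightarrow> \<lbrakk>\<Gamma>\<rbrakk>\<close> interprets the well-typed substitution \<open>s\<close> from \<open>\<Gamma>\<close> to \<open>\<Delta>\<close>.\<close>

definition realises :: "'op ctx \<Rightarrow> (nat \<Rightarrow> 'op val) \<Rightarrow> 'op ctx \<Rightarrow> 'm \<Rightarrow> bool" where
  "realises \<Delta> s \<Gamma> h \<longleftrightarrow> Dom \<M> h = sem_ctx \<M> \<Delta> \<and> Cod \<M> h = sem_ctx \<M> \<Gamma> \<and>
     (\<forall>i < length \<Gamma>. val_ty \<Delta> (s i) (\<Gamma> ! i) \<and> sem_val \<M> (s i) \<Delta> = sem_var \<M> \<Gamma> i \<cdot> h)"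

text \<open>Interprets \<open>up_sub s\<close> whenever \<open>h\<close> interprets
  \<open>s\<close>: the new variable is passed through unchanged.\<close>

definition lift :: "'op ctx \<Rightarrow> 'op ty \<Rightarrow> 'm \<Rightarrow> 'm" where
  "lift \<Delta> A h = pair \<M> (h \<cdot> pr1 \<M> (sem_ctx \<M> \<Delta>) (sem_ty \<M> A)) (pr2 \<M> (sem_ctx \<M> \<Delta>) (sem_ty \<M> A))"

lemma realises_Dom_Cod:
  assumes "realises \<Delta> s \<Gamma> h"
  shows "Dom \<M> h = sem_ctx \<M> \<Delta>" "Cod \<M> h = sem_ctx \<M> \<Gamma>"
  using assms by (simp_all add: realises_def)

lemma realises_Cons:
  assumes "realises \<Delta> (\<lambda>i. s (Suc i)) \<Gamma> h" "val_ty \<Delta> (s 0) A"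
  shows "realises \<Delta> s (A # \<Gamma>) (pair \<M> h (sem_val \<M> (s 0) \<Delta>))"
  unfolding realises_def
proof (intro conjI allI impI)
  note dc = realises_Dom_Cod[OF assms(1)] sem_val_Dom_Cod[OF assms(2)]
  show "Dom \<M> (pair \<M> h (sem_val \<M> (s 0) \<Delta>)) = sem_ctx \<M> \<Delta>"
    "Cod \<M> (pair \<M> h (sem_val \<M> (s 0) \<Delta>)) = sem_ctx \<M> (A # \<Gamma>)"
    using dc by simp_all
  fix i assume i: "i < length (A # \<Gamma>)"
  show "val_ty \<Delta> (s i) ((A # \<Gamma>) ! i)"
    "sem_val \<M> (s i) \<Delta> = sem_var \<M> (A # \<Gamma>) i \<cdot> pair \<M> h (sem_val \<M> (s 0) \<Delta>)"
    using i assms dc sem_var_Dom_Cod[of "i - 1" \<Gamma>] by (cases i; simp add: realises_def)+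
qed

lemma realises_ren:
  assumes "Dom \<M> h = sem_ctx \<M> \<Delta>" "Cod \<M> h = sem_ctx \<M> \<Gamma>"
    and "\<And>i. i < length \<Gamma> \<Longrightarrow> r i < length \<Delta> \<and> \<Delta> ! r i = \<Gamma> ! i \<and> sem_var \<M> \<Delta> (r i) = sem_var \<M> \<Gamma> i \<cdot> h"
  shows "realises \<Delta> (Var \<circ> r) \<Gamma> h"
  unfolding realises_def
proof (intro conjI allI impI)
  fix i assume "i < length \<Gamma>"
  from assms(3)[OF this] show "val_ty \<Delta> ((Var \<circ> r) i) (\<Gamma> ! i)"
    "sem_val \<M> ((Var \<circ> r) i) \<Delta> = sem_var \<M> \<Gamma> i \<cdot> h"
    using ty_Var[of "r i" \<Delta>] by simp_all
qed (use assms(1,2) in simp_all)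

lemma realises_Var: "realises \<Gamma> Var \<Gamma> (Id \<M> (sem_ctx \<M> \<Gamma>))"
  using realises_ren[of "Id \<M> (sem_ctx \<M> \<Gamma>)" \<Gamma> \<Gamma> id] sem_var_Dom_Cod[of _ \<Gamma>] by simp

lemma realises_Suc: "realises (A # \<Gamma>) (Var \<circ> Suc) \<Gamma> (pr1 \<M> (sem_ctx \<M> \<Gamma>) (sem_ty \<M> A))"
  by (rule realises_ren) auto

lemma realises_up_ren:
  assumes "realises \<Delta> (Var \<circ> r) \<Gamma> h"
  shows "realises (A # \<Delta>) (Var \<circ> up_ren r) (A # \<Gamma>) (lift \<Delta> A h)"
proof (rule realises_ren)
  note dc = realises_Dom_Cod[OF assms]
  show "Dom \<M> (lift \<Delta> A h) = sem_ctx \<M> (A # \<Delta>)" "Cod \<M> (lift \<Delta> A h) = sem_ctx \<M> (A # \<Gamma>)"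
    using dc by (simp_all add: lift_def)
  fix i assume i: "i < length (A # \<Gamma>)"
  show "up_ren r i < length (A # \<Delta>) \<and> (A # \<Delta>) ! up_ren r i = (A # \<Gamma>) ! i \<and>
      sem_var \<M> (A # \<Delta>) (up_ren r i) = sem_var \<M> (A # \<Gamma>) i \<cdot> lift \<Delta> A h"
  proof (cases i)
    case 0
    with dc show ?thesis by (simp add: up_ren_def lift_def)
  next
    case (Suc j)
    with i assms have j: "val_ty \<Delta> (Var (r j)) (\<Gamma> ! j)" "sem_var \<M> \<Delta> (r j) = sem_var \<M> \<Gamma> j \<cdot> h"
      by (simp_all add: realises_def)
    \<comment> \<open>\<open>realises\<close> records only typing, but for a variable inversion
      recovers its position in \<Delta>.\<close>
    from j(1) have "r j < length \<Delta> \<and> \<Delta> ! r j = \<Gamma> ! j"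
      by (auto elim: val_ty_VarE)
    with j(2) dc Suc i sem_var_Dom_Cod[of j \<Gamma>] show ?thesis
      by (simp add: up_ren_def lift_def)
  qed
qed

text \<open>
  Closure under \<open>up_sub\<close> is elementary for renamings; for arbitrary substitutions it needs weakening,
  which is the conclusion for renamings. Hence the parameter \<open>P\<close>.
\<close>

lemma substitution_induct:
  assumes up: "\<And>s \<Delta> \<Gamma> h A. P s \<Longrightarrow> realises \<Delta> s \<Gamma> h \<Longrightarrow>
    P (up_sub s) \<and> realises (A # \<Delta>) (up_sub s) (A # \<Gamma>) (lift \<Delta> A h)"
  shows "val_ty \<Gamma> V A \<Longrightarrow> \<forall>s \<Delta> h. P s \<longrightarrow> realises \<Delta> s \<Gamma> h \<longrightarrow>
      val_ty \<Delta> (sub_val s V) A \<and> sem_val \<M> (sub_val s V) \<Delta> = sem_val \<M> V \<Gamma> \<cdot> h"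
    and "comp_ty \<Gamma> M C \<Longrightarrow> \<forall>s \<Delta> h. P s \<longrightarrow> realises \<Delta> s \<Gamma> h \<longrightarrow>
      comp_ty \<Delta> (sub_comp s M) C \<and> sem_comp \<M> (sub_comp s M) \<Delta> = sem_comp \<M> M \<Gamma> \<cdot> h"
    and "hdl_ty \<Gamma> H \<Sigma> C \<Longrightarrow> \<forall>s \<Delta> h. P s \<longrightarrow> realises \<Delta> s \<Gamma> h \<longrightarrow>
      hdl_ty \<Delta> (fmmap (sub_comp (up_sub (up_sub s))) H) \<Sigma> C \<and>
      sem_hdl \<M> (fmmap (sub_comp (up_sub (up_sub s))) H) \<Delta> \<Sigma> C = sem_hdl \<M> H \<Gamma> \<Sigma> C \<cdot> h"
proof (induction rule: val_ty_comp_ty_hdl_ty.inducts)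
  case (ty_Var i \<Gamma>)
  then show ?case by (simp add: realises_def)
next
  case (ty_Lam A \<Gamma> M C)
  obtain B \<Sigma> where C: "C = Comp B \<Sigma>" by (cases C)
  show ?case
  proof (intro allI impI)
    fix s \<Delta> h assume s: "P s" "realises \<Delta> s \<Gamma> h"
    have IH: "comp_ty (A # \<Delta>) (sub_comp (up_sub s) M) C"
      "sem_comp \<M> (sub_comp (up_sub s) M) (A # \<Delta>) = sem_comp \<M> M (A # \<Gamma>) \<cdot> lift \<Delta> A h"
      using up[OF s] ty_Lam.IH by blast+
    then show "val_ty \<Delta> (sub_val s (Lam A M)) (Fun A C) \<and>
      sem_val \<M> (sub_val s (Lam A M)) \<Delta> = sem_val \<M> (Lam A M) \<Gamma> \<cdot> h"
      using ty_Lam.hyps sem_comp_Dom_Cod[of "A # \<Gamma>" M B \<Sigma>] realises_Dom_Cod[OF s(2)]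
      by (auto simp: C sem_Lam cur_Cmp lift_def intro: val_ty_comp_ty_hdl_ty.ty_Lam)
  qed
next
  case (ty_Tup Vs As \<Gamma>)
  show ?case
  proof (intro allI impI)
    fix s \<Delta> h assume s: "P s" "realises \<Delta> s \<Gamma> h"
    note dc = realises_Dom_Cod[OF s(2)]
    let ?V = "Tup Vs" and ?W = "sub_val s (Tup Vs)"
    have IH: "val_ty \<Delta> (sub_val s (Vs ! i)) (As ! i)"
      "sem_val \<M> (sub_val s (Vs ! i)) \<Delta> = sem_val \<M> (Vs ! i) \<Gamma> \<cdot> h" if "i < length As" for i
      using s ty_Tup.IH that by blast+
    have V: "val_ty \<Gamma> ?V (Prod As)" and W: "val_ty \<Delta> ?W (Prod As)"
      using ty_Tup.hyps IH(1) by (auto intro!: val_ty_comp_ty_hdl_ty.ty_Tup)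
    note dV = sem_val_Dom_Cod[OF V] and dW = sem_val_Dom_Cod[OF W]
    have pV: "Prj \<M> (map (sem_ty \<M>) As) i \<cdot> sem_val \<M> ?V \<Gamma> = sem_val \<M> (Vs ! i) \<Gamma>"
      if "i < length As" for i
      using ty_Tup.hyps that by (intro sem_Tup(2)) (auto intro: sem_typed)
    have pW: "Prj \<M> (map (sem_ty \<M>) As) i \<cdot> sem_val \<M> ?W \<Delta> = sem_val \<M> (sub_val s (Vs ! i)) \<Delta>"
      if "i < length As" for i
      using sem_Tup(2)[of "map (sub_val s) Vs" As \<Delta> i] ty_Tup.hyps(1) IH(1) that
      by (auto intro: sem_typed)
    have "sem_val \<M> ?W \<Delta> = sem_val \<M> ?V \<Gamma> \<cdot> h"
    proof (rule Prd_eqI[of _ "map (sem_ty \<M>) As"])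
      fix i assume i: "i < length (map (sem_ty \<M>) As)"
      \<comment> \<open>Nested to the left, the projection meets the tuple and \<open>pV\<close>
        applies.\<close>
      have "Prj \<M> (map (sem_ty \<M>) As) i \<cdot> (sem_val \<M> ?V \<Gamma> \<cdot> h)
        = (Prj \<M> (map (sem_ty \<M>) As) i \<cdot> sem_val \<M> ?V \<Gamma>) \<cdot> h"
        using i dV dc by simp
      with i pV pW IH(2) show "Prj \<M> (map (sem_ty \<M>) As) i \<cdot> sem_val \<M> ?W \<Delta>
        = Prj \<M> (map (sem_ty \<M>) As) i \<cdot> (sem_val \<M> ?V \<Gamma> \<cdot> h)"
        by (metis length_map)
    qed (use dV dW dc in simp_all)
    with W show "val_ty \<Delta> ?W (Prod As) \<and> sem_val \<M> ?W \<Delta> = sem_val \<M> ?V \<Gamma> \<cdot> h" by blast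
  qed
next
  case (ty_Proj \<Gamma> V As i)
  show ?case
  proof (intro allI impI)
    fix s \<Delta> h assume s: "P s" "realises \<Delta> s \<Gamma> h"
    with ty_Proj.IH have "val_ty \<Delta> (sub_val s V) (Prod As)" "sem_val \<M> (sub_val s V) \<Delta> = sem_val \<M> V \<Gamma> \<cdot> h"
      by blast+
    with ty_Proj.hyps sem_val_Dom_Cod[OF ty_Proj.hyps(1)] realises_Dom_Cod[OF s(2)]
    show "val_ty \<Delta> (sub_val s (Proj i V)) (As ! i) \<and>
        sem_val \<M> (sub_val s (Proj i V)) \<Delta> = sem_val \<M> (Proj i V) \<Gamma> \<cdot> h"
      by (auto simp: sem_Proj intro: val_ty_comp_ty_hdl_ty.ty_Proj)
  qed
next
  case (ty_App \<Gamma> V A C W)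
  obtain B \<Sigma> where C: "C = Comp B \<Sigma>" by (cases C)
  show ?case
  proof (intro allI impI)
    fix s \<Delta> h assume s: "P s" "realises \<Delta> s \<Gamma> h"
    with ty_App.IH have "val_ty \<Delta> (sub_val s V) (Fun A C)" "sem_val \<M> (sub_val s V) \<Delta> = sem_val \<M> V \<Gamma> \<cdot> h"
      "val_ty \<Delta> (sub_val s W) A" "sem_val \<M> (sub_val s W) \<Delta> = sem_val \<M> W \<Gamma> \<cdot> h"
      by blast+
    with ty_App.hyps sem_val_Dom_Cod[OF ty_App.hyps(1)] sem_val_Dom_Cod[OF ty_App.hyps(2)]
      realises_Dom_Cod[OF s(2)]
    show "comp_ty \<Delta> (sub_comp s (App V W)) C \<and>
        sem_comp \<M> (sub_comp s (App V W)) \<Delta> = sem_comp \<M> (App V W) \<Gamma> \<cdot> h"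
      by (auto simp: C sem_App intro: val_ty_comp_ty_hdl_ty.ty_App)
  qed
next
  case (ty_Ret \<Gamma> V A \<Sigma>)
  show ?case
  proof (intro allI impI)
    fix s \<Delta> h assume s: "P s" "realises \<Delta> s \<Gamma> h"
    with ty_Ret.IH have "val_ty \<Delta> (sub_val s V) A" "sem_val \<M> (sub_val s V) \<Delta> = sem_val \<M> V \<Gamma> \<cdot> h"
      by blast+
    with ty_Ret.hyps sem_val_Dom_Cod[OF ty_Ret.hyps(1)] realises_Dom_Cod[OF s(2)]
    show "comp_ty \<Delta> (sub_comp s (Ret \<Sigma> V)) (Comp A \<Sigma>) \<and>
        sem_comp \<M> (sub_comp s (Ret \<Sigma> V)) \<Delta> = sem_comp \<M> (Ret \<Sigma> V) \<Gamma> \<cdot> h"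
      by (auto simp: sem_Ret intro: val_ty_comp_ty_hdl_ty.ty_Ret)
  qed
next
  case (ty_Let \<Gamma> M A \<Sigma> N B)
  show ?case
  proof (intro allI impI)
    fix s \<Delta> h assume s: "P s" "realises \<Delta> s \<Gamma> h"
    have M: "comp_ty \<Delta> (sub_comp s M) (Comp A \<Sigma>)" "sem_comp \<M> (sub_comp s M) \<Delta> = sem_comp \<M> M \<Gamma> \<cdot> h"
      using s ty_Let.IH(1) by blast+
    have N: "comp_ty (A # \<Delta>) (sub_comp (up_sub s) N) (Comp B \<Sigma>)"
      "sem_comp \<M> (sub_comp (up_sub s) N) (A # \<Delta>) = sem_comp \<M> N (A # \<Gamma>) \<cdot> lift \<Delta> A h"
      using up[OF s] ty_Let.IH(2) by blast+
    have "sem_comp \<M> (LetIn (sub_comp s M) (sub_comp (up_sub s) N)) \<Delta> = sem_comp \<M> (LetIn M N) \<Gamma> \<cdot> h"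
      unfolding sem_Let_typed[OF M(1) N(1)] sem_Let_typed[OF ty_Let.hyps]
      using sem_comp_Dom_Cod[OF ty_Let.hyps(1)] sem_comp_Dom_Cod[OF ty_Let.hyps(2)] realises_Dom_Cod[OF s(2)]
      by (simp add: M(2) N(2) mon.smap_Cmp lift_def)
    with M(1) N(1) show "comp_ty \<Delta> (sub_comp s (LetIn M N)) (Comp B \<Sigma>) \<and>
        sem_comp \<M> (sub_comp s (LetIn M N)) \<Delta> = sem_comp \<M> (LetIn M N) \<Gamma> \<cdot> h"
      by (auto intro: val_ty_comp_ty_hdl_ty.ty_Let)
  qed
next
  case (ty_Op \<Sigma> op A B \<Gamma> V)
  show ?case
  proof (intro allI impI)
    fix s \<Delta> h assume s: "P s" "realises \<Delta> s \<Gamma> h"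
    with ty_Op.IH have "val_ty \<Delta> (sub_val s V) A" "sem_val \<M> (sub_val s V) \<Delta> = sem_val \<M> V \<Gamma> \<cdot> h"
      by blast+
    with ty_Op.hyps sem_val_Dom_Cod[OF ty_Op.hyps(2)] realises_Dom_Cod[OF s(2)]
      OpMor_Dom_Cod[OF fmlookup_sem_sig[OF ty_Op.hyps(1)], of \<M>]
    show "comp_ty \<Delta> (sub_comp s (Op \<Sigma> op V)) (Comp B \<Sigma>) \<and>
        sem_comp \<M> (sub_comp s (Op \<Sigma> op V)) \<Delta> = sem_comp \<M> (Op \<Sigma> op V) \<Gamma> \<cdot> h"
      by (auto simp: sem_comp.simps(4) intro: val_ty_comp_ty_hdl_ty.ty_Op)
  qed
next
  case (ty_Handle \<Gamma> M A \<Sigma> H C N)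
  obtain B \<Sigma>' where C: "C = Comp B \<Sigma>'" by (cases C)
  note hyps = ty_Handle.hyps[unfolded C]
  show ?case
  proof (intro allI impI)
    fix s \<Delta> h assume s: "P s" "realises \<Delta> s \<Gamma> h"
    let ?H = "fmmap (sub_comp (up_sub (up_sub s))) H"
    have M: "comp_ty \<Delta> (sub_comp s M) (Comp A \<Sigma>)" "sem_comp \<M> (sub_comp s M) \<Delta> = sem_comp \<M> M \<Gamma> \<cdot> h"
      using s ty_Handle.IH(1) by blast+
    have H: "hdl_ty \<Delta> ?H \<Sigma> (Comp B \<Sigma>')" "sem_hdl \<M> ?H \<Delta> \<Sigma> (Comp B \<Sigma>') = sem_hdl \<M> H \<Gamma> \<Sigma> (Comp B \<Sigma>') \<cdot> h"
      using s ty_Handle.IH(2) C by blast+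
    have N: "comp_ty (A # \<Delta>) (sub_comp (up_sub s) N) (Comp B \<Sigma>')"
      "sem_comp \<M> (sub_comp (up_sub s) N) (A # \<Delta>) = sem_comp \<M> N (A # \<Gamma>) \<cdot> lift \<Delta> A h"
      using up[OF s] ty_Handle.IH(3) C by blast+
    have "sem_comp \<M> (Handle (sub_comp s M) ?H (sub_comp (up_sub s) N)) \<Delta> = sem_comp \<M> (Handle M H N) \<Gamma> \<cdot> h"
      unfolding sem_Handle_typed[OF M(1) N(1)] sem_Handle_typed[OF hyps(1,3)]
      using sem_comp_Dom_Cod[OF hyps(1)] sem_comp_Dom_Cod[OF hyps(3)] realises_Dom_Cod[OF s(2)]
        sem_hdl_typed(1,2)[OF hyps(2)]
      by (simp add: M(2) N(2) H(2) mon.smap_Cmp lift_def)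
    with M(1) N(1) H(1) C show "comp_ty \<Delta> (sub_comp s (Handle M H N)) C \<and>
        sem_comp \<M> (sub_comp s (Handle M H N)) \<Delta> = sem_comp \<M> (Handle M H N) \<Gamma> \<cdot> h"
      by (auto intro: val_ty_comp_ty_hdl_ty.ty_Handle)
  qed
next
  case (ty_Hdl H \<Sigma> C \<Gamma>)
  obtain X \<Sigma>' where C: "C = Comp X \<Sigma>'" by (cases C)
  show ?case
  proof (intro allI impI)
    fix s \<Delta> h assume s: "P s" "realises \<Delta> s \<Gamma> h"
    note dc = realises_Dom_Cod[OF s(2)]
    let ?H = "fmmap (sub_comp (up_sub (up_sub s))) H"
    let ?lift = "\<lambda>A B. lift (A # \<Delta>) (Fun B C) (lift \<Delta> A h)"
    have IH: "comp_ty (Fun B C # A # \<Delta>) (sub_comp (up_sub (up_sub s)) M) C"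
      "sem_comp \<M> (sub_comp (up_sub (up_sub s)) M) (Fun B C # A # \<Delta>) = sem_comp \<M> M (Fun B C # A # \<Gamma>) \<cdot> ?lift A B"
      if "fmlookup \<Sigma> op = Some (A, B)" "fmlookup H op = Some M" for op A B M
    proof -
      \<comment> \<open>A clause binds \<open>x\<close> and \<open>k\<close>, so \<open>up\<close>
        is used twice; its first use also supplies the \<open>P\<close> that the second one
        requires.\<close>
      have "P (up_sub s)" "realises (A # \<Delta>) (up_sub s) (A # \<Gamma>) (lift \<Delta> A h)"
        using up[OF s] by blast+
      from up[OF this, of "Fun B C"]
      show "comp_ty (Fun B C # A # \<Delta>) (sub_comp (up_sub (up_sub s)) M) C"
        "sem_comp \<M> (sub_comp (up_sub (up_sub s)) M) (Fun B C # A # \<Delta>) = sem_comp \<M> M (Fun B C # A # \<Gamma>) \<cdot> ?lift A B"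
        using ty_Hdl.IH[OF that] by blast+
    qed
    have H: "hdl_ty \<Gamma> H \<Sigma> C" and H': "hdl_ty \<Delta> ?H \<Sigma> C"
      using ty_Hdl.hyps IH(1) by (auto intro!: val_ty_comp_ty_hdl_ty.ty_Hdl)
    note tH = sem_hdl_typed[OF H[unfolded C]] and tH' = sem_hdl_typed[OF H'[unfolded C]]
    have "sem_hdl \<M> ?H \<Delta> \<Sigma> (Comp X \<Sigma>') = sem_hdl \<M> H \<Gamma> \<Sigma> (Comp X \<Sigma>') \<cdot> h"
    \<comment> \<open>Each projection of a handler is a curried clause, so naturality of currying
      carries \<open>h\<close> below the two bound variables, where it matches the doubly lifted
      morphism of \<open>IH\<close>.\<close>
    proof (rule hobj_eqI)
      fix op a b assume "fmlookup (sem_sig \<M> \<Sigma>) op = Some (a, b)"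
      then obtain A B where op: "fmlookup \<Sigma> op = Some (A, B)" and ab: "a = sem_ty \<M> A" "b = sem_ty \<M> B"
        by (auto simp: sem_sig_def simp del: sem_sig_simp)
      from op ty_Hdl.hyps(1) obtain M where M: "fmlookup H op = Some M"
        by (metis fmlookup_dom_iff fmdomI)
      have tM: "comp_ty (Fun B C # A # \<Gamma>) M (Comp X \<Sigma>')"
        using ty_Hdl.hyps(2)[OF op M] C by simp
      let ?p = "hprj \<M> (sem_sig \<M> \<Sigma>) (sem_sig \<M> \<Sigma>') (sem_ty \<M> X) op"
      have "?p \<cdot> (sem_hdl \<M> H \<Gamma> \<Sigma> (Comp X \<Sigma>') \<cdot> h) = (?p \<cdot> sem_hdl \<M> H \<Gamma> \<Sigma> (Comp X \<Sigma>')) \<cdot> h"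
        using dc tH(1,2) hprj_Dom_Cod[OF fmlookup_sem_sig[OF op, of \<M>]] by simp
      also have "\<dots> = ?p \<cdot> sem_hdl \<M> ?H \<Delta> \<Sigma> (Comp X \<Sigma>')"
        using dc tH(3)[OF op M] tH'(3)[OF op, of "sub_comp (up_sub (up_sub s)) M"] M IH(2)[OF op M]
          sem_comp_Dom_Cod[OF tM]
        by (simp add: C cur_Cmp lift_def assoc_inv_def Let_def)
      finally show "?p \<cdot> sem_hdl \<M> ?H \<Delta> \<Sigma> (Comp X \<Sigma>') = ?p \<cdot> (sem_hdl \<M> H \<Gamma> \<Sigma> (Comp X \<Sigma>') \<cdot> h)" ..
    qed (use dc tH(1,2) tH'(1,2) in simp_all)
    with H' C show "hdl_ty \<Delta> ?H \<Sigma> C \<and> sem_hdl \<M> ?H \<Delta> \<Sigma> C = sem_hdl \<M> H \<Gamma> \<Sigma> C \<cdot> h"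
      by simp
  qed
qed

section \<open>The renaming and substitution lemmas and their instances\<close>

lemma renaming:
  assumes "realises \<Delta> (Var \<circ> r) \<Gamma> h"
  shows "val_ty \<Gamma> V A \<Longrightarrow> val_ty \<Delta> (ren_val r V) A \<and> sem_val \<M> (ren_val r V) \<Delta> = sem_val \<M> V \<Gamma> \<cdot> h"
    and "comp_ty \<Gamma> M C \<Longrightarrow> comp_ty \<Delta> (ren_comp r M) C \<and> sem_comp \<M> (ren_comp r M) \<Delta> = sem_comp \<M> M \<Gamma> \<cdot> h"
    and "hdl_ty \<Gamma> H \<Sigma> C \<Longrightarrow>
      hdl_ty \<Delta> (ren_hdl r H) \<Sigma> C \<and> sem_hdl \<M> (ren_hdl r H) \<Delta> \<Sigma> C = sem_hdl \<M> H \<Gamma> \<Sigma> C \<cdot> h"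
proof -
  \<comment> \<open>The instance of \<open>P\<close> is being a renaming; the lifted substitution is
    one again, and \<open>realises_up_ren\<close> needs no weakening.\<close>
  have closed: "(\<exists>r. up_sub s = Var \<circ> r) \<and> realises (A # \<Delta>) (up_sub s) (A # \<Gamma>) (lift \<Delta> A h)"
    if "\<exists>r. s = Var \<circ> r" "realises \<Delta> s \<Gamma> h" for s \<Delta> \<Gamma> h A
    using that realises_up_ren by (auto simp: up_sub_Var)
  show "val_ty \<Gamma> V A \<Longrightarrow> val_ty \<Delta> (ren_val r V) A \<and> sem_val \<M> (ren_val r V) \<Delta> = sem_val \<M> V \<Gamma> \<cdot> h"
    unfolding ren_eq_sub using assms
    by (intro substitution_induct(1)[of "\<lambda>s. \<exists>r. s = Var \<circ> r", rule_format] closed) auto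
  show "comp_ty \<Gamma> M C \<Longrightarrow> comp_ty \<Delta> (ren_comp r M) C \<and> sem_comp \<M> (ren_comp r M) \<Delta> = sem_comp \<M> M \<Gamma> \<cdot> h"
    unfolding ren_eq_sub using assms
    by (intro substitution_induct(2)[of "\<lambda>s. \<exists>r. s = Var \<circ> r", rule_format] closed) auto
  show "hdl_ty \<Gamma> H \<Sigma> C \<Longrightarrow>
      hdl_ty \<Delta> (ren_hdl r H) \<Sigma> C \<and> sem_hdl \<M> (ren_hdl r H) \<Delta> \<Sigma> C = sem_hdl \<M> H \<Gamma> \<Sigma> C \<cdot> h"
    unfolding ren_hdl_eq_sub using assms
    by (intro substitution_induct(3)[of "\<lambda>s. \<exists>r. s = Var \<circ> r", rule_format] closed) auto
qed

text \<open>Lifting shifts every \<open>s i\<close>, and by \<open>renaming\<close> at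
  \<open>Suc\<close> a shift is precomposition with the first projection.\<close>

lemma realises_up_sub:
  assumes "realises \<Delta> s \<Gamma> h"
  shows "realises (A # \<Delta>) (up_sub s) (A # \<Gamma>) (lift \<Delta> A h)"
proof -
  note dc = realises_Dom_Cod[OF assms]
  have "realises (A # \<Delta>) (\<lambda>i. up_sub s (Suc i)) \<Gamma> (h \<cdot> pr1 \<M> (sem_ctx \<M> \<Delta>) (sem_ty \<M> A))"
    unfolding realises_def
  proof (intro conjI allI impI)
    fix i assume i: "i < length \<Gamma>"
    with assms have "val_ty \<Delta> (s i) (\<Gamma> ! i)" "sem_val \<M> (s i) \<Delta> = sem_var \<M> \<Gamma> i \<cdot> h"
      by (simp_all add: realises_def)
    with renaming(1)[OF realises_Suc] dc i sem_var_Dom_Cod[of i \<Gamma>]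
    show "val_ty (A # \<Delta>) (up_sub s (Suc i)) (\<Gamma> ! i)"
      "sem_val \<M> (up_sub s (Suc i)) (A # \<Delta>)
        = sem_var \<M> \<Gamma> i \<cdot> (h \<cdot> pr1 \<M> (sem_ctx \<M> \<Delta>) (sem_ty \<M> A))"
      by (simp_all add: up_sub_def)
  qed (use dc in simp_all)
  from realises_Cons[OF this, of A] ty_Var[of 0 "A # \<Delta>"] show ?thesis
    by (simp add: up_sub_def lift_def)
qed

lemma substitution:
  assumes "realises \<Delta> s \<Gamma> h"
  shows "val_ty \<Gamma> V A \<Longrightarrow> val_ty \<Delta> (sub_val s V) A \<and> sem_val \<M> (sub_val s V) \<Delta> = sem_val \<M> V \<Gamma> \<cdot> h"
    and "comp_ty \<Gamma> M C \<Longrightarrow> comp_ty \<Delta> (sub_comp s M) C \<and> sem_comp \<M> (sub_comp s M) \<Delta> = sem_comp \<M> M \<Gamma> \<cdot> h"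
  by (rule substitution_induct(1,2)[of "\<lambda>_. True", rule_format]; use assms in \<open>simp add: realises_up_sub\<close>)+

lemma inst1:
  assumes "comp_ty (A # \<Gamma>) M C" "val_ty \<Gamma> V A"
  shows "comp_ty \<Gamma> (inst1 M V) C"
    and "sem_comp \<M> (inst1 M V) \<Gamma> =
      sem_comp \<M> M (A # \<Gamma>) \<cdot> pair \<M> (Id \<M> (sem_ctx \<M> \<Gamma>)) (sem_val \<M> V \<Gamma>)"
proof -
  have "realises \<Gamma> (case_nat V Var) (A # \<Gamma>) (pair \<M> (Id \<M> (sem_ctx \<M> \<Gamma>)) (sem_val \<M> V \<Gamma>))"
    using realises_Cons[of \<Gamma> "case_nat V Var" \<Gamma> "Id \<M> (sem_ctx \<M> \<Gamma>)" A] realises_Var assms(2) by simp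
  from substitution(2)[OF this assms(1)]
  show "comp_ty \<Gamma> (inst1 M V) C" "sem_comp \<M> (inst1 M V) \<Gamma> =
      sem_comp \<M> M (A # \<Gamma>) \<cdot> pair \<M> (Id \<M> (sem_ctx \<M> \<Gamma>)) (sem_val \<M> V \<Gamma>)"
    by simp_all
qed

text \<open>Both values live in \<Gamma> and are substituted simultaneously, so no shift occurs;
  \<open>V\<close> is paired first because \<open>k\<close> has index 0 and is outermost in the
  context.\<close>

lemma inst2:
  assumes "comp_ty (B # A # \<Gamma>) M C" "val_ty \<Gamma> V A" "val_ty \<Gamma> K B"
  shows "comp_ty \<Gamma> (inst2 M V K) C"
    and "sem_comp \<M> (inst2 M V K) \<Gamma> = sem_comp \<M> M (B # A # \<Gamma>) \<cdot>
      pair \<M> (pair \<M> (Id \<M> (sem_ctx \<M> \<Gamma>)) (sem_val \<M> V \<Gamma>)) (sem_val \<M> K \<Gamma>)"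
proof -
  let ?h = "pair \<M> (Id \<M> (sem_ctx \<M> \<Gamma>)) (sem_val \<M> V \<Gamma>)"
  have "realises \<Gamma> (case_nat V Var) (A # \<Gamma>) ?h"
    using realises_Cons[of \<Gamma> "case_nat V Var" \<Gamma> "Id \<M> (sem_ctx \<M> \<Gamma>)" A] realises_Var assms(2) by simp
  then have "realises \<Gamma> (case_nat K (case_nat V Var)) (B # A # \<Gamma>) (pair \<M> ?h (sem_val \<M> K \<Gamma>))"
    using realises_Cons[of \<Gamma> "case_nat K (case_nat V Var)" "A # \<Gamma>" ?h B] assms(3) by simp
  from substitution(2)[OF this assms(1)]
  show "comp_ty \<Gamma> (inst2 M V K) C" "sem_comp \<M> (inst2 M V K) \<Gamma> = sem_comp \<M> M (B # A # \<Gamma>) \<cdot>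
      pair \<M> ?h (sem_val \<M> K \<Gamma>)"
    by simp_all
qed


section \<open>Soundness\<close>

text \<open>Weakening is precomposition with the first projection and \<open>Var 0\<close> is the
  second, which is exactly the shape of \<open>cur_ev_pair\<close>.\<close>

lemma sem_eta_Fun:
  assumes "val_ty \<Gamma> V (Fun A C)"
  shows "val_ty \<Gamma> (Lam A (App (ren_val Suc V) (Var 0))) (Fun A C)"
    and "sem_val \<M> (Lam A (App (ren_val Suc V) (Var 0))) \<Gamma> = sem_val \<M> V \<Gamma>"
proof -
  obtain B \<Sigma> where C: "C = Comp B \<Sigma>" by (cases C)
  from renaming(1)[OF realises_Suc assms]
  have V: "val_ty (A # \<Gamma>) (ren_val Suc V) (Fun A C)"
    "sem_val \<M> (ren_val Suc V) (A # \<Gamma>) = sem_val \<M> V \<Gamma> \<cdot> pr1 \<M> (sem_ctx \<M> \<Gamma>) (sem_ty \<M> A)"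
    by blast+
  have M: "comp_ty (A # \<Gamma>) (App (ren_val Suc V) (Var 0)) C"
    using ty_App[OF V(1)] ty_Var[of 0 "A # \<Gamma>"] by simp
  then show "val_ty \<Gamma> (Lam A (App (ren_val Suc V) (Var 0))) (Fun A C)"
    by (rule ty_Lam)
  from M V sem_val_Dom_Cod[OF assms] show "sem_val \<M> (Lam A (App (ren_val Suc V) (Var 0))) \<Gamma> = sem_val \<M> V \<Gamma>"
    by (simp add: C sem_Lam sem_App cur_ev_pair)
qed

lemma sem_eta_Prod:
  assumes "val_ty \<Gamma> V (Prod As)"
  defines "W \<equiv> Tup (map (\<lambda>i. Proj i V) [0..<length As])"
  shows "val_ty \<Gamma> W (Prod As)" and "sem_val \<M> W \<Gamma> = sem_val \<M> V \<Gamma>"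
proof -
  have P: "val_ty \<Gamma> (map (\<lambda>i. Proj i V) [0..<length As] ! i) (As ! i)" if "i < length As" for i
    using that ty_Proj[OF assms(1) that] by simp
  then show W: "val_ty \<Gamma> W (Prod As)"
    unfolding W_def by (intro ty_Tup) simp_all
  show "sem_val \<M> W \<Gamma> = sem_val \<M> V \<Gamma>"
  proof (rule Prd_eqI[of _ "map (sem_ty \<M>) As"])
    fix i assume "i < length (map (sem_ty \<M>) As)"
    then show "Prj \<M> (map (sem_ty \<M>) As) i \<cdot> sem_val \<M> W \<Gamma> = Prj \<M> (map (sem_ty \<M>) As) i \<cdot> sem_val \<M> V \<Gamma>"
      unfolding W_def using sem_Tup(2)[of "map (\<lambda>i. Proj i V) [0..<length As]" As \<Gamma> i] sem_typed(1)[OF P]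
      by (simp add: sem_Proj[OF assms(1)])
  qed (use sem_val_Dom_Cod[OF assms(1)] sem_val_Dom_Cod[OF W] in simp_all)
qed

text \<open>\<open>smap_Mu\<close> brings both multiplications to the front, the associativity law
  trades the inner one for its image under the functor, and \<open>Map_smap\<close> pushes that one
  below the binder of \<open>L\<close>.\<close>

lemma sem_let_let:
  assumes L: "comp_ty \<Gamma> L (Comp A \<Sigma>)" and M: "comp_ty (A # \<Gamma>) M (Comp B \<Sigma>)"
    and N: "comp_ty (B # \<Gamma>) N (Comp D \<Sigma>)"
  shows "comp_ty \<Gamma> (LetIn L (LetIn M (ren_comp (up_ren Suc) N))) (Comp D \<Sigma>)"
    and "sem_comp \<M> (LetIn (LetIn L M) N) \<Gamma> = sem_comp \<M> (LetIn L (LetIn M (ren_comp (up_ren Suc) N))) \<Gamma>"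
proof -
  let ?S = "sem_sig \<M> \<Sigma>" and ?a = "sem_ty \<M> A" and ?b = "sem_ty \<M> B" and ?d = "sem_ty \<M> D"
  let ?l = "sem_comp \<M> L \<Gamma>" and ?m = "sem_comp \<M> M (A # \<Gamma>)" and ?n = "sem_comp \<M> N (B # \<Gamma>)"
  let ?N = "ren_comp (up_ren Suc) N"
  let ?n' = "?n \<cdot> lift (A # \<Gamma>) B (pr1 \<M> (sem_ctx \<M> \<Gamma>) ?a)"
  note dc = sem_comp_Dom_Cod[OF L] sem_comp_Dom_Cod[OF M] sem_comp_Dom_Cod[OF N]
  from renaming(2)[OF realises_up_ren[OF realises_Suc] N]
  have N': "comp_ty (B # A # \<Gamma>) ?N (Comp D \<Sigma>)" "sem_comp \<M> ?N (B # A # \<Gamma>) = ?n'"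
    by blast+
  note MN = ty_Let[OF M N'(1)] and LM = ty_Let[OF L M]
  show "comp_ty \<Gamma> (LetIn L (LetIn M ?N)) (Comp D \<Sigma>)"
    by (rule ty_Let[OF L MN])
  have "sem_comp \<M> (LetIn (LetIn L M) N) \<Gamma> = mu \<M> ?S ?d \<cdot>
    (mu \<M> ?S (TOb \<M> ?S ?d) \<cdot> mon.smap ?S ?a (mon.smap ?S ?b ?n' ?m) ?l)"
    using dc by (simp add: sem_Let_typed[OF LM N] sem_Let_typed[OF L M] mon.smap_Mu lift_def)
  also have "\<dots> = mu \<M> ?S ?d \<cdot> (TMap \<M> ?S (mu \<M> ?S ?d) \<cdot> mon.smap ?S ?a (mon.smap ?S ?b ?n' ?m) ?l)"
    using dc arg_cong[OF mon.Mu_laws(3)[of ?S ?d], of "\<lambda>k. k \<cdot> mon.smap ?S ?a (mon.smap ?S ?b ?n' ?m) ?l"]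
    by (simp add: lift_def)
  also have "\<dots> = sem_comp \<M> (LetIn L (LetIn M ?N)) \<Gamma>"
    using dc by (simp add: sem_Let_typed[OF L MN] sem_Let_typed[OF M N'(1)] N'(2) mon.Map_smap lift_def)
  finally show "sem_comp \<M> (LetIn (LetIn L M) N) \<Gamma> = sem_comp \<M> (LetIn L (LetIn M ?N)) \<Gamma>" .
qed

text \<open>With the multiplication in front, \<open>Hnd_Mu\<close> replaces it by an inner handling
  under the functor, and \<open>St_smap\<close> carries the handler there. It arrives as
  \<open>?h \<cdot> ?p\<close>, the denotation of the weakened handler
  \<open>ren_hdl Suc H\<close>.\<close>

lemma sem_handle_let:
  assumes L: "comp_ty \<Gamma> L (Comp A \<Sigma>)" and M: "comp_ty (A # \<Gamma>) M (Comp B \<Sigma>)"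
    and H: "hdl_ty \<Gamma> H \<Sigma> (Comp X \<Sigma>')" and N: "comp_ty (B # \<Gamma>) N (Comp X \<Sigma>')"
  shows "comp_ty \<Gamma> (Handle L H (Handle M (ren_hdl Suc H) (ren_comp (up_ren Suc) N))) (Comp X \<Sigma>')"
    and "sem_comp \<M> (Handle (LetIn L M) H N) \<Gamma> =
      sem_comp \<M> (Handle L H (Handle M (ren_hdl Suc H) (ren_comp (up_ren Suc) N))) \<Gamma>"
proof -
  let ?S = "sem_sig \<M> \<Sigma>" and ?S' = "sem_sig \<M> \<Sigma>'"
  let ?a = "sem_ty \<M> A" and ?b = "sem_ty \<M> B" and ?x = "sem_ty \<M> X"
  let ?l = "sem_comp \<M> L \<Gamma>" and ?m = "sem_comp \<M> M (A # \<Gamma>)" and ?n = "sem_comp \<M> N (B # \<Gamma>)"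
  let ?h = "sem_hdl \<M> H \<Gamma> \<Sigma> (Comp X \<Sigma>')"
  let ?N = "ren_comp (up_ren Suc) N"
  let ?p = "pr1 \<M> (sem_ctx \<M> \<Gamma>) ?a"
  let ?n' = "?n \<cdot> lift (A # \<Gamma>) B ?p"
  note dc = sem_comp_Dom_Cod[OF L] sem_comp_Dom_Cod[OF M] sem_comp_Dom_Cod[OF N] sem_hdl_typed(1,2)[OF H]
  from renaming(2)[OF realises_up_ren[OF realises_Suc] N]
  have N': "comp_ty (B # A # \<Gamma>) ?N (Comp X \<Sigma>')" "sem_comp \<M> ?N (B # A # \<Gamma>) = ?n'"
    by blast+
  from renaming(3)[OF realises_Suc H]
  have H': "hdl_ty (A # \<Gamma>) (ren_hdl Suc H) \<Sigma> (Comp X \<Sigma>')"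
    "sem_hdl \<M> (ren_hdl Suc H) (A # \<Gamma>) \<Sigma> (Comp X \<Sigma>') = ?h \<cdot> ?p"
    by blast+
  note MN = ty_Handle[OF M H'(1) N'(1)] and LM = ty_Let[OF L M]
  show "comp_ty \<Gamma> (Handle L H (Handle M (ren_hdl Suc H) ?N)) (Comp X \<Sigma>')"
    by (rule ty_Handle[OF L H MN])
  let ?P = "mon.smap ?S ?b ?n' ?m"
  let ?Q = "mon.smap ?S ?a ?P ?l"
  have P: "Dom \<M> ?P = bprod \<M> (sem_ctx \<M> \<Gamma>) ?a" "Cod \<M> ?P = TOb \<M> ?S (TOb \<M> ?S' ?x)"
    using dc by (simp_all add: lift_def)
  have "sem_comp \<M> (Handle (LetIn L M) H N) \<Gamma> =
      Hnd \<M> ?S ?S' ?x \<cdot> pair \<M> ?h (mu \<M> ?S (TOb \<M> ?S' ?x) \<cdot> ?Q)"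
    using dc by (simp add: sem_Handle_typed[OF LM N] sem_Let_typed[OF L M] mon.smap_Mu lift_def)
  also have "\<dots> = Hnd \<M> ?S ?S' ?x \<cdot> pair \<M> ?h (TMap \<M> ?S (Hnd \<M> ?S ?S' ?x) \<cdot>
      (st \<M> ?S (hobj \<M> ?S ?S' ?x) (TOb \<M> ?S (TOb \<M> ?S' ?x)) \<cdot> pair \<M> ?h ?Q))"
    using dc P by (intro Hnd_Mu) simp_all
  also have "st \<M> ?S (hobj \<M> ?S ?S' ?x) (TOb \<M> ?S (TOb \<M> ?S' ?x)) \<cdot> pair \<M> ?h ?Q
      = mon.smap ?S ?a (pair \<M> (?h \<cdot> ?p) ?P) ?l"
    using mon.St_smap[of ?l ?S ?a ?P ?h] dc P by simp
  also have "TMap \<M> ?S (Hnd \<M> ?S ?S' ?x) \<cdot> mon.smap ?S ?a (pair \<M> (?h \<cdot> ?p) ?P) ?l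
      = mon.smap ?S ?a (Hnd \<M> ?S ?S' ?x \<cdot> pair \<M> (?h \<cdot> ?p) ?P) ?l"
    using dc P by (intro mon.Map_smap) simp_all
  also have "Hnd \<M> ?S ?S' ?x \<cdot> pair \<M> ?h (mon.smap ?S ?a (Hnd \<M> ?S ?S' ?x \<cdot> pair \<M> (?h \<cdot> ?p) ?P) ?l)
      = sem_comp \<M> (Handle L H (Handle M (ren_hdl Suc H) ?N)) \<Gamma>"
    by (simp add: sem_Handle_typed[OF L MN] sem_Handle_typed[OF M N'(1)] N'(2) H'(2))
  finally show "sem_comp \<M> (Handle (LetIn L M) H N) \<Gamma> =
      sem_comp \<M> (Handle L H (Handle M (ren_hdl Suc H) ?N)) \<Gamma>" .
qed

text \<open>\<open>Hnd_op\<close> yields the clause, curried, evaluated at the argument and at the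
  curried \<open>M\<close>, and the latter is the denotation of \<open>Lam B M\<close>. The \<beta>
  law undoes the currying, and \<open>assoc_inv\<close> restores the nesting of context, argument
  and continuation that \<open>inst2\<close> uses.\<close>

lemma sem_handle_op:
  assumes op: "fmlookup \<Sigma> op = Some (A, B)" and V: "val_ty \<Gamma> V A" and H: "hdl_ty \<Gamma> H \<Sigma> (Comp X \<Sigma>')"
    and N: "fmlookup H op = Some N" and M: "comp_ty (B # \<Gamma>) M (Comp X \<Sigma>')"
  shows "comp_ty \<Gamma> (inst2 N V (Lam B M)) (Comp X \<Sigma>')"
    and "sem_comp \<M> (Handle (Op \<Sigma> op V) H M) \<Gamma> = sem_comp \<M> (inst2 N V (Lam B M)) \<Gamma>"
proof -
  let ?S = "sem_sig \<M> \<Sigma>" and ?S' = "sem_sig \<M> \<Sigma>'"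
  let ?a = "sem_ty \<M> A" and ?b = "sem_ty \<M> B" and ?x = "sem_ty \<M> X"
  let ?k = "texp \<M> ?S' ?b ?x" and ?G = "sem_ctx \<M> \<Gamma>"
  let ?v = "sem_val \<M> V \<Gamma>" and ?m = "sem_comp \<M> M (B # \<Gamma>)"
  let ?n = "sem_comp \<M> N (Fun B (Comp X \<Sigma>') # A # \<Gamma>)"
  let ?h = "sem_hdl \<M> H \<Gamma> \<Sigma> (Comp X \<Sigma>')"
  from H op N have tN: "comp_ty (Fun B (Comp X \<Sigma>') # A # \<Gamma>) N (Comp X \<Sigma>')"
    by (auto elim: hdl_ty.cases)
  note K = ty_Lam[OF M]
  from inst2(1)[OF tN V K] show "comp_ty \<Gamma> (inst2 N V (Lam B M)) (Comp X \<Sigma>')" .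
  note dc = sem_val_Dom_Cod[OF V] sem_comp_Dom_Cod[OF M] sem_comp_Dom_Cod[OF tN] sem_hdl_typed(1,2)[OF H]
  have "sem_comp \<M> (Handle (Op \<Sigma> op V) H M) \<Gamma> = ev \<M> ?S' (bprod \<M> ?a ?k) ?x \<cdot>
      pair \<M> (hprj \<M> ?S ?S' ?x op \<cdot> ?h) (pair \<M> ?v (cur \<M> ?S' ?G ?b ?x ?m))"
    using Hnd_op[OF fmlookup_sem_sig[OF op, of \<M>], of ?h ?S' ?x ?v ?m] dc
    by (simp add: sem_Handle_typed[OF ty_Op[OF op V] M] sem_comp.simps(4))
  also have "\<dots> = ?n \<cdot> pair \<M> (pair \<M> (Id \<M> ?G) ?v) (cur \<M> ?S' ?G ?b ?x ?m)"
    using dc by (simp add: sem_hdl_typed(3)[OF H op N] ev_cur assoc_inv_def Let_def)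
  also have "\<dots> = sem_comp \<M> (inst2 N V (Lam B M)) \<Gamma>"
    by (simp add: inst2(2)[OF tN V K] sem_Lam[OF M])
  finally show "sem_comp \<M> (Handle (Op \<Sigma> op V) H M) \<Gamma> = sem_comp \<M> (inst2 N V (Lam B M)) \<Gamma>" .
qed

lemma sem_hdl_cong:
  assumes H: "hdl_ty \<Gamma> H \<Sigma> (Comp X \<Sigma>')" and H': "hdl_ty \<Gamma> H' \<Sigma> (Comp X \<Sigma>')"
    and eq: "\<And>op A B M M'. fmlookup \<Sigma> op = Some (A, B) \<Longrightarrow> fmlookup H op = Some M \<Longrightarrow>
      fmlookup H' op = Some M' \<Longrightarrow>
      sem_comp \<M> M (Fun B (Comp X \<Sigma>') # A # \<Gamma>) = sem_comp \<M> M' (Fun B (Comp X \<Sigma>') # A # \<Gamma>)"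
  shows "sem_hdl \<M> H \<Gamma> \<Sigma> (Comp X \<Sigma>') = sem_hdl \<M> H' \<Gamma> \<Sigma> (Comp X \<Sigma>')"
proof (rule hobj_eqI)
  note t = sem_hdl_typed[OF H] and t' = sem_hdl_typed[OF H']
  show "Cod \<M> (sem_hdl \<M> H \<Gamma> \<Sigma> (Comp X \<Sigma>')) = hobj \<M> (sem_sig \<M> \<Sigma>) (sem_sig \<M> \<Sigma>') (sem_ty \<M> X)"
    "Cod \<M> (sem_hdl \<M> H' \<Gamma> \<Sigma> (Comp X \<Sigma>')) = hobj \<M> (sem_sig \<M> \<Sigma>) (sem_sig \<M> \<Sigma>') (sem_ty \<M> X)"
    "Dom \<M> (sem_hdl \<M> H \<Gamma> \<Sigma> (Comp X \<Sigma>')) = Dom \<M> (sem_hdl \<M> H' \<Gamma> \<Sigma> (Comp X \<Sigma>'))"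
    using t(1,2) t'(1,2) by simp_all
  fix op a b assume "fmlookup (sem_sig \<M> \<Sigma>) op = Some (a, b)"
  then obtain A B where op: "fmlookup \<Sigma> op = Some (A, B)"
    by (auto simp: sem_sig_def simp del: sem_sig_simp)
  have "fmdom H = fmdom \<Sigma>" "fmdom H' = fmdom \<Sigma>"
    using H H' by (auto elim: hdl_ty.cases)
  with op obtain M M' where M: "fmlookup H op = Some M" "fmlookup H' op = Some M'"
    by (metis fmlookup_dom_iff fmdomI)
  show "hprj \<M> (sem_sig \<M> \<Sigma>) (sem_sig \<M> \<Sigma>') (sem_ty \<M> X) op \<cdot> sem_hdl \<M> H \<Gamma> \<Sigma> (Comp X \<Sigma>')
    = hprj \<M> (sem_sig \<M> \<Sigma>) (sem_sig \<M> \<Sigma>') (sem_ty \<M> X) op \<cdot> sem_hdl \<M> H' \<Gamma> \<Sigma> (Comp X \<Sigma>')"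
    using t(3)[OF op M(1)] t'(3)[OF op M(2)] eq[OF op M] by simp
qed

lemma soundness:
  "val_eq \<Gamma> V W A \<Longrightarrow> val_ty \<Gamma> V A \<and> val_ty \<Gamma> W A \<and> sem_val \<M> V \<Gamma> = sem_val \<M> W \<Gamma>"
  "comp_eq \<Gamma> M N C \<Longrightarrow> comp_ty \<Gamma> M C \<and> comp_ty \<Gamma> N C \<and> sem_comp \<M> M \<Gamma> = sem_comp \<M> N \<Gamma>"
  "hdl_eq \<Gamma> H H' \<Sigma> C \<Longrightarrow> hdl_ty \<Gamma> H \<Sigma> C \<and> hdl_ty \<Gamma> H' \<Sigma> C \<and> sem_hdl \<M> H \<Gamma> \<Sigma> C = sem_hdl \<M> H' \<Gamma> \<Sigma> C"
proof (induction rule: val_eq_comp_eq_hdl_eq.inducts)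
  case (cong_Lam A \<Gamma> M M' C)
  obtain B \<Sigma> where C: "C = Comp B \<Sigma>" by (cases C)
  with cong_Lam.IH show ?case by (auto simp: sem_Lam intro: ty_Lam)
next
  case (cong_Tup Vs As Vs' \<Gamma>)
  then have "map (\<lambda>V. sem_val \<M> V \<Gamma>) Vs = map (\<lambda>V. sem_val \<M> V \<Gamma>) Vs'"
    by (intro nth_equalityI) auto
  then have "sem_val \<M> (Tup Vs) \<Gamma> = sem_val \<M> (Tup Vs') \<Gamma>"
    by (simp only: sem_val.simps)
  with cong_Tup show ?case by (blast intro: ty_Tup)
next
  case (cong_Proj \<Gamma> V V' As i)
  then show ?case by (auto simp: sem_Proj intro: ty_Proj)
next
  case (cong_App \<Gamma> V V' A C W W')
  obtain B \<Sigma> where C: "C = Comp B \<Sigma>" by (cases C)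
  with cong_App.IH show ?case by (auto simp: sem_App intro: ty_App)
next
  case (cong_Ret \<Gamma> V V' A \<Sigma>)
  then show ?case by (auto simp: sem_Ret intro: ty_Ret)
next
  case (cong_Let \<Gamma> M M' A \<Sigma> N N' B)
  then show ?case by (auto simp: sem_Let_typed intro: ty_Let)
next
  case (cong_Op \<Sigma> op A B \<Gamma> V V')
  then show ?case by (auto simp: sem_comp.simps(4) intro: ty_Op)
next
  case (cong_Handle \<Gamma> M M' A \<Sigma> H H' C N N')
  obtain B \<Sigma>' where C: "C = Comp B \<Sigma>'" by (cases C)
  with cong_Handle.IH show ?case by (auto simp: sem_Handle_typed intro: ty_Handle)
next
  case (cong_Hdl H \<Sigma> H' C \<Gamma>)
  obtain X \<Sigma>' where C: "C = Comp X \<Sigma>'" by (cases C)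
  \<comment> \<open>The induction hypothesis speaks of a pair of clauses, so typing a clause of one
    handler needs its partner in the other.\<close>
  have both: "\<exists>M M'. fmlookup H op = Some M \<and> fmlookup H' op = Some M'" if "op |\<in>| fmdom \<Sigma>" for op
    using that cong_Hdl.hyps(1,2) by (metis fmlookup_dom_iff)
  have "comp_ty (Fun B C # A # \<Gamma>) M C" if "fmlookup \<Sigma> op = Some (A, B)" "fmlookup H op = Some M" for op A B M
    using both[OF fmdomI[OF that(1)]] that cong_Hdl.IH by blast
  with cong_Hdl.hyps(1) have H: "hdl_ty \<Gamma> H \<Sigma> C" by (rule ty_Hdl)
  have "comp_ty (Fun B C # A # \<Gamma>) M C" if "fmlookup \<Sigma> op = Some (A, B)" "fmlookup H' op = Some M" for op A B M
    using both[OF fmdomI[OF that(1)]] that cong_Hdl.IH by blast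
  with cong_Hdl.hyps(2) have H': "hdl_ty \<Gamma> H' \<Sigma> C" by (rule ty_Hdl)
  have "sem_hdl \<M> H \<Gamma> \<Sigma> C = sem_hdl \<M> H' \<Gamma> \<Sigma> C"
    unfolding C by (rule sem_hdl_cong) (use H H' cong_Hdl.IH C in blast)+
  with H H' show ?case by blast
next
  case (beta_Fun A \<Gamma> M C V)
  obtain B \<Sigma> where C: "C = Comp B \<Sigma>" by (cases C)
  note M = beta_Fun(1)[unfolded C] and V = beta_Fun(2)
  \<comment> \<open>\<open>ev_cur\<close> leaves the body precomposed with the identity paired with
    the argument, which is \<open>inst1\<close>.\<close>
  show ?case
    using inst1[OF M V] ty_App[OF ty_Lam[OF M] V] sem_App[OF ty_Lam[OF M]] sem_comp_Dom_Cod[OF M]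
      sem_val_Dom_Cod[OF V]
    by (simp add: C sem_Lam[OF M] ev_cur)
next
  case (eta_Fun \<Gamma> V A C)
  with sem_eta_Fun show ?case by metis
next
  case (beta_Prod \<Gamma> Vs As i)
  then have l: "length Vs = length As" and V: "\<And>i. i < length As \<Longrightarrow> val_ty \<Gamma> (Vs ! i) (As ! i)"
    by (auto elim: val_ty_TupE)
  with beta_Prod sem_Tup(2)[OF l sem_typed(1)[OF V]] show ?case
    by (auto simp: sem_Proj intro: ty_Proj)
next
  case (eta_Prod \<Gamma> V As)
  with sem_eta_Prod show ?case by metis
next
  case (let_ret \<Gamma> V A M B \<Sigma>)
  note V = let_ret(1) and M = let_ret(2)
  let ?S = "sem_sig \<M> \<Sigma>" and ?k = "sem_comp \<M> M (A # \<Gamma>) \<cdot> pair \<M> (Id \<M> (sem_ctx \<M> \<Gamma>)) (sem_val \<M> V \<Gamma>)"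
  note dc = sem_val_Dom_Cod[OF V] sem_comp_Dom_Cod[OF M]
  \<comment> \<open>\<open>smap_Eta\<close> exposes a unit directly under the
    multiplication.\<close>
  have "sem_comp \<M> (LetIn (Ret \<Sigma> V) M) \<Gamma> = mu \<M> ?S (sem_ty \<M> B) \<cdot> (eta \<M> ?S (TOb \<M> ?S (sem_ty \<M> B)) \<cdot> ?k)"
    using dc by (simp add: sem_Let_typed[OF ty_Ret[OF V] M] sem_Ret[OF V] mon.smap_Eta)
  also have "\<dots> = ?k"
    using dc arg_cong[OF mon.Mu_laws(1)[of ?S "sem_ty \<M> B"], of "\<lambda>f. f \<cdot> ?k"] by simp
  finally show ?case
    using inst1[OF M V] ty_Let[OF ty_Ret[OF V] M] by simp
next
  case (ret_let \<Gamma> M A \<Sigma>)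
  let ?S = "sem_sig \<M> \<Sigma>" and ?a = "sem_ty \<M> A"
  note dc = sem_comp_Dom_Cod[OF ret_let]
  have v: "val_ty (A # \<Gamma>) (Var 0) A"
    using ty_Var[of 0 "A # \<Gamma>"] by simp
  \<comment> \<open>Returning the bound variable is a unit after the second projection;
    \<open>Map_smap\<close> splits the unit off, so that a monad law and \<open>smap_pr2\<close>
    finish.\<close>
  have "sem_comp \<M> (LetIn M (Ret \<Sigma> (Var 0))) \<Gamma> =
      mu \<M> ?S ?a \<cdot> (TMap \<M> ?S (eta \<M> ?S ?a) \<cdot> mon.smap ?S ?a (pr2 \<M> (sem_ctx \<M> \<Gamma>) ?a) (sem_comp \<M> M \<Gamma>))"
    using dc by (simp add: sem_Let_typed[OF ret_let ty_Ret[OF v]] sem_Ret[OF v] mon.Map_smap)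
  also have "\<dots> = sem_comp \<M> M \<Gamma>"
    using dc mon.smap_pr2[of "sem_comp \<M> M \<Gamma>" ?S ?a]
      arg_cong[OF mon.Mu_laws(2)[of ?S ?a], of "\<lambda>f. f \<cdot> sem_comp \<M> M \<Gamma>"] by simp
  finally show ?case
    using ret_let ty_Let[OF ret_let ty_Ret[OF v]] by simp
next
  case (let_let \<Gamma> L A \<Sigma> M B N D)
  with sem_let_let[OF let_let] show ?case by (blast intro: ty_Let)
next
  case (handle_ret \<Gamma> V A H \<Sigma> C M)
  obtain X \<Sigma>' where C: "C = Comp X \<Sigma>'" by (cases C)
  note V = handle_ret(1) and H = handle_ret(2)[unfolded C] and M = handle_ret(3)[unfolded C]
  \<comment> \<open>\<open>smap_Eta\<close> presents the handled computation as a unit, and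
    \<open>Hnd_Eta\<close> then discards the handler.\<close>
  show ?case
    using inst1[OF M V] ty_Handle[OF ty_Ret[OF V] H M] sem_val_Dom_Cod[OF V] sem_comp_Dom_Cod[OF M]
      sem_hdl_typed(1,2)[OF H]
    by (simp add: C sem_Handle_typed[OF ty_Ret[OF V] M] sem_Ret[OF V] mon.smap_Eta Hnd_Eta)
next
  case (handle_let \<Gamma> L A \<Sigma> M B H C N)
  obtain X \<Sigma>' where C: "C = Comp X \<Sigma>'" by (cases C)
  from handle_let sem_handle_let[OF handle_let[unfolded C]] show ?case
    unfolding C by (blast intro: ty_Handle ty_Let)
next
  case (handle_op \<Sigma> op A B \<Gamma> V H C N M)
  obtain X \<Sigma>' where C: "C = Comp X \<Sigma>'" by (cases C)
  from handle_op sem_handle_op[OF handle_op[unfolded C]] show ?case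
    unfolding C by (blast intro: ty_Handle ty_Op)
qed auto

end

theorem theorem4p4:
  fixes \<M> :: "('op, 'o, 'm) model"
    and \<Gamma> :: "'op ctx"
  assumes "lambda_eff_model \<M>"
  shows "(\<forall>V W A. val_eq \<Gamma> V W A \<longrightarrow> sem_val \<M> V \<Gamma> = sem_val \<M> W \<Gamma>) \<and>
    (\<forall>M N C. comp_eq \<Gamma> M N C \<longrightarrow> sem_comp \<M> M \<Gamma> = sem_comp \<M> N \<Gamma>) \<and>
    (\<forall>H H' \<Sigma> C. hdl_eq \<Gamma> H H' \<Sigma> C \<longrightarrow> sem_hdl \<M> H \<Gamma> \<Sigma> C = sem_hdl \<M> H' \<Gamma> \<Sigma> C)"
proof -
  interpret eff_model \<M>
    using assms by unfold_locales
  show ?thesis using soundness by blast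
qed

end
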